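(* Let $(X_i,Y_i)$, $i=1,\dots,n$, be pairs of interval-valued random variables with realizations $X_i=x_i=[c_i,d_i]$, $Y_i=y_i=[a_i,b_i]$, in one-to-one correspondence with their random internal parameters $\Theta_{i1}=(\Theta_{i1}^x,\Theta_{i1}^y)$ (internal means) and $\Theta_{i2}=(\Theta_{i2}^x,\Theta_{i2}^y,\Theta_{i2}^{xy})$ (internal variances and covariance). Suppose that $\Theta_{i1}$ is bivariate normal with means $\mu_x,\mu_y$, variances $\sigma_x^2,\sigma_y^2$ and correlation $\rho$, that $\Theta_{i2}$ has the bivariate Wishart distribution with $\nu>2$ degrees of freedom and parameters $\gamma_1,\gamma_2,\gamma_3$, and that the joint density of $(\Theta_{i1},\Theta_{i2})$ is the product of these two densities. Let $W^x$ and $W^y$ denote the overall variables, with $$\Theta_{i1}^x=E(W^x\mid X_i=x_i),\quad \Theta_{i1}^y=E(W^y\mid Y_i=y_i),\quad \Theta_{i2}^x=\mathrm{Var}(W^x\mid X_i=x_i),\quad \Theta_{i2}^y=\mathrm{Var}(W^y\mid Y_i=y_i),$$ $$\Theta_{i2}^{xy}=\mathrm{Cov}(W^x,W^y\mid X_i=x_i,Y_i=y_i).$$ Then $$E(W^x)=\mu_x,\qquad E(W^y)=\mu_y,\qquad \mathrm{Var}(W^x)=\nu\gamma_1+\sigma_x^2,\qquad \mathrm{Var}(W^y)=\nu\gamma_2+\sigma_y^2,$$ $$\mathrm{Cov}(W^x,W^y)=\nu\gamma_3+\rho\sigma_x\sigma_y.$$ Consequently, when observations are uniformly distributed within the intervals,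 the overall maximum likelihood estimators, obtained by substituting the maximum likelihood estimators of $(\mu_x,\mu_y,\sigma_x^2,\sigma_y^2,\rho,\gamma_1,\gamma_2,\gamma_3)$ (given in the context), are $$\widehat{E(W^x)}=\hat\mu_x=\frac1{2n}\sum_{i=1}^n(c_i+d_i),\qquad \widehat{E(W^y)}=\hat\mu_y=\frac1{2n}\sum_{i=1}^n(a_i+b_i),$$ $$\widehat{\mathrm{Var}(W^x)}=\nu\hat\gamma_1+\hat\sigma_x^2=\frac1{12n}\sum_{i=1}^n(d_i-c_i)^2+\frac1n\sum_{i=1}^n\Big[\frac{c_i+d_i}{2}-\hat\mu_x\Big]^2,$$ $$\widehat{\mathrm{Var}(W^y)}=\nu\hat\gamma_2+\hat\sigma_y^2=\frac1{12n}\sum_{i=1}^n(b_i-a_i)^2+\frac1n\sum_{i=1}^n\Big[\frac{a_i+b_i}{2}-\hat\mu_y\Big]^2,$$ $$\widehat{\mathrm{Cov}(W^x,W^y)}=\nu\hat\gamma_3+\hat\rho\hat\sigma_x\hat\sigma_y=\frac1{12n}\sum_{i=1}^n(b_i-a_i)(d_i-c_i)+\frac1n\sum_{i=1}^n\Big[\frac{a_i+b_i}{2}-\hat\mu_y\Big]\Big[\frac{c_i+d_i}{2}-\hat\mu_x\Big].$$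
   Context: The bivariate Wishart distribution with $\nu$ degrees of freedom and parameters $\gamma_1,\gamma_2,\gamma_3$ has density, for $s>0$, $t>0$, $-\sqrt{st}<r<\sqrt{st}$, $$\frac{(\gamma_1\gamma_2-\gamma_3^2)^{-\nu/2}}{2^\nu\sqrt{\pi}\,\Gamma(\frac{\nu}{2})\Gamma(\frac{\nu-1}{2})}(st-r^2)^{\frac{\nu-3}{2}}\exp\left\{-\frac{\gamma_1\gamma_2}{2(\gamma_1\gamma_2-\gamma_3^2)}\left(\frac{s}{\gamma_1}+\frac{t}{\gamma_2}-\frac{2\gamma_3 r}{\gamma_1\gamma_2}\right)\right\}.$$ The likelihood of the parameters is the product over $i=1,\dots,n$ of the normal density at $\theta_{i1}$ times the Wishart density at $\theta_{i2}$, where $\theta_{i1},\theta_{i2}$ are realizations of $\Theta_{i1},\Theta_{i2}$. For internally uniform observations these realizations are $\theta_{i1}^x=(c_i+d_i)/2$, $\theta_{i1}^y=(a_i+b_i)/2$, $\theta_{i2}^x=(d_i-c_i)^2/12$, $\theta_{i2}^y=(b_i-a_i)^2/12$, $\theta_{i2}^{xy}=(d_i-c_i)(b_i-a_i)/12$. The maximum likelihood estimators of the parameters are $\hat\mu_x=\frac1n\sum_i\theta_{i1}^x$, $\hat\mu_y=\frac1n\sum_i\theta_{i1}^y$, $\hat\sigma_x^2=\frac1n\sum_i(\theta_{i1}^x-\hat\mu_x)^2$, $\hat\sigma_y^2=\frac1n\sum_i(\theta_{i1}^y-\hat\mu_y)^2$, $\hat\rho=\hat\sigma_{xy}/(\hat\sigma_x\hat\sigma_y)$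 with $\hat\sigma_{xy}=\frac1n\sum_i(\theta_{i1}^y-\hat\mu_y)(\theta_{i1}^x-\hat\mu_x)$, and $\hat\gamma_1=\frac1{n\nu}\sum_i\theta_{i2}^x$, $\hat\gamma_2=\frac1{n\nu}\sum_i\theta_{i2}^y$, $\hat\gamma_3=\frac1{n\nu}\sum_i\theta_{i2}^{xy}$.
   Formalization: Added assumption: the internal means are also the conditional means given the pair, E(W^x|X_i,Y_i)=E(W^x|X_i) and E(W^y|X_i,Y_i)=E(W^y|Y_i); without it the formula for Cov(W^x,W^y) can fail. *)

theory Defs
  imports "HOL-Probability.Probability"
begin

text \<open>
  A closed interval is represented by its pair of endpoints \<open>(lower, upper)\<close>, so an
  interval-valued random variable is a random vector in \<open>real \<times> real\<close> with
  \<open>fst \<le> snd\<close>.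
\<close>

definition interval_valued_rv :: "'a measure \<Rightarrow> ('a \<Rightarrow> real \<times> real) \<Rightarrow> bool" where
  "interval_valued_rv M X \<longleftrightarrow>
     X \<in> borel_measurable M \<and> (\<forall>\<omega>\<in>space M. fst (X \<omega>) \<le> snd (X \<omega>))"

text \<open>Conditional moments given a random element \<open>Z\<close>, i.e. given the sigma-algebra it generates.\<close>

definition cond_expect ::
  "'a measure \<Rightarrow> ('a \<Rightarrow> 'b::topological_space) \<Rightarrow> ('a \<Rightarrow> real) \<Rightarrow> 'a \<Rightarrow> real" where
  "cond_expect M Z U = real_cond_exp M (vimage_algebra (space M) Z borel) U"

definition cond_cov ::
  "'a measure \<Rightarrow> ('a \<Rightarrow> 'b::topological_space) \<Rightarrow> ('a \<Rightarrow> real) \<Rightarrow> ('a \<Rightarrow> real) \<Rightarrow> 'a \<Rightarrow> real" where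
  "cond_cov M Z U V =
     cond_expect M Z (\<lambda>\<omega>. (U \<omega> - cond_expect M Z U \<omega>) * (V \<omega> - cond_expect M Z V \<omega>))"

definition cond_var ::
  "'a measure \<Rightarrow> ('a \<Rightarrow> 'b::topological_space) \<Rightarrow> ('a \<Rightarrow> real) \<Rightarrow> 'a \<Rightarrow> real" where
  "cond_var M Z U = cond_expect M Z (\<lambda>\<omega>. (U \<omega> - cond_expect M Z U \<omega>)\<^sup>2)"

definition covariance :: "'a measure \<Rightarrow> ('a \<Rightarrow> real) \<Rightarrow> ('a \<Rightarrow> real) \<Rightarrow> real" where
  "covariance M U V =
     (LINT \<omega>|M. (U \<omega> - (LINT \<eta>|M. U \<eta>)) * (V \<omega> - (LINT \<eta>|M. V \<eta>)))"

definition bivariate_normal_density ::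
  "real \<Rightarrow> real \<Rightarrow> real \<Rightarrow> real \<Rightarrow> real \<Rightarrow> real \<times> real \<Rightarrow> real" where
  "bivariate_normal_density \<mu>x \<mu>y \<sigma>x \<sigma>y \<rho> = (\<lambda>(u, v).
     1 / (2 * pi * \<sigma>x * \<sigma>y * sqrt (1 - \<rho>\<^sup>2)) *
     exp (- 1 / (2 * (1 - \<rho>\<^sup>2)) *
       (((u - \<mu>x) / \<sigma>x)\<^sup>2 - 2 * \<rho> * ((u - \<mu>x) / \<sigma>x) * ((v - \<mu>y) / \<sigma>y)
        + ((v - \<mu>y) / \<sigma>y)\<^sup>2)))"

text \<open>The coordinates \<open>(s, t, r)\<close> are the two variances followed by the covariance.\<close>

definition bivariate_wishart_density ::
  "real \<Rightarrow> real \<Rightarrow> real \<Rightarrow> real \<Rightarrow> real \<times> real \<times> real \<Rightarrow> real" where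
  "bivariate_wishart_density \<nu> \<gamma>1 \<gamma>2 \<gamma>3 = (\<lambda>(s, t, r).
     if s > 0 \<and> t > 0 \<and> - sqrt (s * t) < r \<and> r < sqrt (s * t) then
       (\<gamma>1 * \<gamma>2 - \<gamma>3\<^sup>2) powr (- \<nu> / 2)
         / (2 powr \<nu> * sqrt pi * Gamma (\<nu> / 2) * Gamma ((\<nu> - 1) / 2))
       * (s * t - r\<^sup>2) powr ((\<nu> - 3) / 2)
       * exp (- (\<gamma>1 * \<gamma>2) / (2 * (\<gamma>1 * \<gamma>2 - \<gamma>3\<^sup>2))
              * (s / \<gamma>1 + t / \<gamma>2 - 2 * \<gamma>3 * r / (\<gamma>1 * \<gamma>2)))
     else 0)"

text \<open>
  Maximum likelihood estimators of the normal parameters (\<open>mle_mean\<close>, \<open>mle_var\<close>, \<open>mle_cov\<close>,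
  \<open>mle_corr\<close>) and of a Wishart parameter (\<open>mle_gamma\<close>), as functions of the realizations
  \<open>x 1, \<dots>, x n\<close> of the relevant coordinate of the internal parameters.  If a sample
  variance vanishes, \<open>mle_corr\<close> is 0 by the convention for division by zero.
\<close>

definition mle_mean :: "nat \<Rightarrow> (nat \<Rightarrow> real) \<Rightarrow> real" where
  "mle_mean n x = 1 / real n * (\<Sum>i=1..n. x i)"

definition mle_var :: "nat \<Rightarrow> (nat \<Rightarrow> real) \<Rightarrow> real" where
  "mle_var n x = 1 / real n * (\<Sum>i=1..n. (x i - mle_mean n x)\<^sup>2)"

definition mle_cov :: "nat \<Rightarrow> (nat \<Rightarrow> real) \<Rightarrow> (nat \<Rightarrow> real) \<Rightarrow> real" where
  "mle_cov n x y = 1 / real n * (\<Sum>i=1..n. (y i - mle_mean n y) * (x i - mle_mean n x))"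

definition mle_corr :: "nat \<Rightarrow> (nat \<Rightarrow> real) \<Rightarrow> (nat \<Rightarrow> real) \<Rightarrow> real" where
  "mle_corr n x y = mle_cov n x y / (sqrt (mle_var n x) * sqrt (mle_var n y))"

definition mle_gamma :: "nat \<Rightarrow> real \<Rightarrow> (nat \<Rightarrow> real) \<Rightarrow> real" where
  "mle_gamma n \<nu> z = 1 / (real n * \<nu>) * (\<Sum>i=1..n. z i)"

text \<open>
  Modelling of the main statement.  The overall variables are a family \<open>Wx i, Wy i\<close>; a single
  pair of overall variables is the constant family.  The family is needed to keep independent
  observations admissible: for one square-integrable \<open>W\<close> and independent \<open>X 1, X 2\<close>,
  \<open>Var(W | X 1) \<ge> Var(E(W | X 2))\<close>, a positive constant, whereas Wishart variances are not
  bounded away from 0.  The covariance formula needs the internal means to be conditional means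
  given the pair \<open>(X i, Y i)\<close> as well (the assumption \<open>internal_means_joint\<close>): otherwise
  \<open>E(W\<^sup>x | X, Y)\<close> and \<open>E(W\<^sup>x | X)\<close> may have different covariances with \<open>E(W\<^sup>y | X, Y)\<close>.
\<close>

end

theory Submission
  imports Defs
begin

text \<open>
  The laws of total expectation and total covariance reduce the overall moments to the moments of
  the internal parameters.  Square integrability of the overall variables is not assumed: it holds
  because the Wishart variances are almost surely positive, so the nonnegative conditional
  expectation defining the conditional variance is almost surely finite (an infinite value would have
  been turned into 0).  Both the normal law and the Wishart law of (variance, covariance) have a
  density of the form \<open>p u * normal_density (m u) (\<tau> u) v\<close>, so that \<open>p\<close> is the density of the first
  coordinate and \<open>m u\<close> the regression of the second one on it; for the Wishart law \<open>p\<close> is a gamma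
  density with mean \<open>\<nu> \<gamma>1\<close> and \<open>m s = (\<gamma>3 / \<gamma>1) s\<close>.
\<close>

section \<open>Conditional expectation and covariance\<close>

text \<open>\<open>real_cond_exp\<close> is built with \<open>enn2real\<close>, which sends infinity
  to 0. A strictly positive value therefore certifies that the nonnegative conditional expectation
  of \<open>f\<close> is finite and equal to it, and \<open>nn_cond_exp\<close> preserves the
  integral.\<close>

lemma (in sigma_finite_subalgebra) integrable_if_real_cond_exp_pos:
  assumes [measurable]: "f \<in> borel_measurable M" and nonneg: "\<And>x. 0 \<le> f x"
    and pos: "AE x in M. 0 < real_cond_exp M F f x"
    and int: "integrable M (real_cond_exp M F f)"
  shows "integrable M f"
proof -
  have neg: "AE x in M. nn_cond_exp M F (\<lambda>x. ennreal (- f x)) x = 0"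
  proof -
    have "(\<lambda>x. ennreal (- f x)) = (\<lambda>x. 0)"
      using nonneg by (auto simp: ennreal_neg)
    then show ?thesis
      using nn_cond_exp_F_meas[of "\<lambda>_. 0"] by auto
  qed
  have eq: "AE x in M. nn_cond_exp M F (\<lambda>x. ennreal (f x)) x = ennreal (real_cond_exp M F f x)"
    using neg pos
  proof eventually_elim
    case (elim x)
    then have "0 < enn2real (nn_cond_exp M F (\<lambda>x. ennreal (f x)) x)"
      by (simp add: real_cond_exp_def)
    then show ?case
      using elim by (auto simp: real_cond_exp_def enn2real_positive_iff)
  qed
  have "(\<integral>\<^sup>+x. f x \<partial>M) = (\<integral>\<^sup>+x. nn_cond_exp M F (\<lambda>x. ennreal (f x)) x \<partial>M)"
    using nn_cond_exp_intg[of "\<lambda>_. 1" "\<lambda>x. ennreal (f x)"] by simp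
  also have "\<dots> = (\<integral>\<^sup>+x. real_cond_exp M F f x \<partial>M)"
    using eq by (rule nn_integral_cong_AE)
  also have "\<dots> < \<infinity>"
    using integrableD(2)[OF int] pos
    by (smt (verit, best) nn_integral_mono abs_ge_self ennreal_leI le_less_trans real_norm_def top.not_eq_extremum infinity_ennreal_def)
  finally show ?thesis
    using nonneg by (intro integrableI_nonneg) auto
qed

lemma integrable_product_if_squares:
  fixes f g :: "'a \<Rightarrow> real"
  assumes [measurable]: "f \<in> borel_measurable M" "g \<in> borel_measurable M"
    and "integrable M (\<lambda>x. (f x)\<^sup>2)" "integrable M (\<lambda>x. (g x)\<^sup>2)"
  shows "integrable M (\<lambda>x. f x * g x)"
proof (rule Bochner_Integration.integrable_bound)
  show "integrable M (\<lambda>x. (f x)\<^sup>2 + (g x)\<^sup>2)" using assms by simp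
  have "\<bar>x * y\<bar> \<le> x\<^sup>2 + y\<^sup>2" for x y :: real
    using sum_squares_bound[of "\<bar>x\<bar>" "\<bar>y\<bar>"] zero_le_mult_iff[of "\<bar>x\<bar>" "\<bar>y\<bar>"]
    unfolding abs_mult power2_abs by linarith
  then show "AE x in M. norm (f x * g x) \<le> norm ((f x)\<^sup>2 + (g x)\<^sup>2)"
    by simp
qed simp

lemma integrable_square_add:
  fixes f g :: "'a \<Rightarrow> real"
  assumes [measurable]: "f \<in> borel_measurable M" "g \<in> borel_measurable M"
    and "integrable M (\<lambda>x. (f x)\<^sup>2)" "integrable M (\<lambda>x. (g x)\<^sup>2)"
  shows "integrable M (\<lambda>x. (f x + g x)\<^sup>2)"
proof -
  have "integrable M (\<lambda>x. (f x)\<^sup>2 + (g x)\<^sup>2 + 2 * (f x * g x))"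
    using assms integrable_product_if_squares[OF assms] by (intro Bochner_Integration.integrable_add) auto
  then show ?thesis
    by (simp add: power2_sum mult.assoc)
qed

lemma integrable_square_diff:
  fixes f g :: "'a \<Rightarrow> real"
  assumes "f \<in> borel_measurable M" "g \<in> borel_measurable M"
    and "integrable M (\<lambda>x. (f x)\<^sup>2)" "integrable M (\<lambda>x. (g x)\<^sup>2)"
  shows "integrable M (\<lambda>x. (f x - g x)\<^sup>2)"
  using integrable_square_add[of f M "\<lambda>x. - g x"] assms by simp

lemma integrable_square_cong_AE:
  fixes f g :: "'a \<Rightarrow> real"
  assumes [measurable]: "f \<in> borel_measurable M" "g \<in> borel_measurable M"
    and "integrable M (\<lambda>x. (f x)\<^sup>2)" and eq: "AE x in M. f x = g x"
  shows "integrable M (\<lambda>x. (g x)\<^sup>2)"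
proof (rule integrable_cong_AE_imp[OF assms(3)])
  show "AE x in M. (f x)\<^sup>2 = (g x)\<^sup>2"
    using eq by eventually_elim simp
qed simp

lemma (in prob_space) covariance_eq:
  assumes "integrable M U" "integrable M V" "integrable M (\<lambda>x. U x * V x)"
  shows "covariance M U V = expectation (\<lambda>x. U x * V x) - expectation U * expectation V"
proof -
  have "covariance M U V = expectation (\<lambda>x. U x * V x - expectation V * U x - expectation U * V x
          + expectation U * expectation V)"
    unfolding covariance_def by (intro Bochner_Integration.integral_cong) (auto simp: algebra_simps)
  also have "\<dots> = expectation (\<lambda>x. U x * V x) - expectation U * expectation V"
    using assms by (simp add: prob_space)
  finally show ?thesis .
qed

text \<open>Both \<open>A\<close> and \<open>B\<close> are measurable for \<open>F\<close>, so
  averaging against them replaces the other variable by its conditional expectation: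
  \<open>E(U B) = E(A V) = E(A B)\<close>. Expanding the product of residuals then leaves
  \<open>E(U V) - E(A B)\<close>.\<close>

lemma (in prob_space) total_covariance:
  fixes U V :: "'a \<Rightarrow> real" and F :: "'a measure"
  defines "A \<equiv> real_cond_exp M F U" and "B \<equiv> real_cond_exp M F V"
  assumes "subalgebra M F"
    and [measurable]: "U \<in> borel_measurable M" "V \<in> borel_measurable M"
    and sq: "integrable M (\<lambda>x. (U x)\<^sup>2)" "integrable M (\<lambda>x. (V x)\<^sup>2)"
      "integrable M (\<lambda>x. (A x)\<^sup>2)" "integrable M (\<lambda>x. (B x)\<^sup>2)"
  shows "covariance M U V = expectation (\<lambda>x. (U x - A x) * (V x - B x)) + covariance M A B"
proof -
  interpret F: finite_measure_subalgebra M F by standard fact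
  have [measurable]: "A \<in> borel_measurable M" "B \<in> borel_measurable M"
    unfolding A_def B_def by measurable
  have [measurable]: "A \<in> borel_measurable F" "B \<in> borel_measurable F"
    unfolding A_def B_def by measurable
  have int: "integrable M U" "integrable M V" "integrable M A" "integrable M B"
    using sq by (auto intro: square_integrable_imp_integrable)
  have prod: "integrable M (\<lambda>x. U x * V x)" "integrable M (\<lambda>x. U x * B x)"
    "integrable M (\<lambda>x. A x * V x)" "integrable M (\<lambda>x. A x * B x)"
    using sq by (auto intro: integrable_product_if_squares)
  have "expectation (\<lambda>x. U x * B x) = expectation (\<lambda>x. A x * B x)"
    using F.real_cond_exp_intg(2)[of B U] prod unfolding A_def by (simp add: mult.commute)
  moreover have "expectation (\<lambda>x. A x * V x) = expectation (\<lambda>x. A x * B x)"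
    using F.real_cond_exp_intg(2)[of A V] prod unfolding B_def by simp
  moreover have "expectation A = expectation U" "expectation B = expectation V"
    unfolding A_def B_def using int by (auto intro: F.real_cond_exp_int)
  moreover have "expectation (\<lambda>x. (U x - A x) * (V x - B x)) =
    expectation (\<lambda>x. U x * V x - U x * B x - A x * V x + A x * B x)"
    by (intro Bochner_Integration.integral_cong) (auto simp: algebra_simps)
  ultimately show ?thesis
    using int prod by (simp add: covariance_eq)
qed

section \<open>Densities with normal fibres\<close>

text \<open>Conditionally on \<open>U = u\<close>, \<open>V\<close> is normal with mean
  \<open>m u\<close> and standard deviation \<open>\<tau> u\<close>: integrating out
  \<open>v\<close> leaves \<open>p u\<close>, and the first moment along the fibre is
  \<open>m u\<close>. Positivity of \<open>\<tau> u\<close> is asked only where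
  \<open>p u \<noteq> 0\<close>, because the Wishart scale \<open>sqrt (s * D / \<gamma>1)\<close>
  is positive only for \<open>s > 0\<close>.\<close>

lemma (in prob_space)
  fixes U V :: "'a \<Rightarrow> real"
  assumes D: "distributed M lborel (\<lambda>\<omega>. (U \<omega>, V \<omega>))
      (\<lambda>(u, v). ennreal (p u * normal_density (m u) (\<tau> u) v))"
    and p_nonneg: "\<And>u. 0 \<le> p u" and \<tau>_pos: "\<And>u. p u \<noteq> 0 \<Longrightarrow> 0 < \<tau> u"
    and [measurable]: "p \<in> borel_measurable borel" "m \<in> borel_measurable borel"
      "\<tau> \<in> borel_measurable borel"
  shows distributed_normal_fibres_marginal: "distributed M lborel U (\<lambda>u. ennreal (p u))"
    and expectation_normal_fibres:
      "g \<in> borel_measurable borel \<Longrightarrow> integrable M (\<lambda>\<omega>. g (U \<omega>) * V \<omega>) \<Longrightarrow>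
        expectation (\<lambda>\<omega>. g (U \<omega>) * V \<omega>) = expectation (\<lambda>\<omega>. g (U \<omega>) * m (U \<omega>))"
proof -
  have D': "distributed M (lborel \<Otimes>\<^sub>M lborel) (\<lambda>\<omega>. (U \<omega>, V \<omega>))
      (\<lambda>(u, v). ennreal (p u * normal_density (m u) (\<tau> u) v))"
    using D by (simp add: lborel_prod)
  have "(\<integral>\<^sup>+v. ennreal (p u * normal_density (m u) (\<tau> u) v) \<partial>lborel) = ennreal (p u)" for u
  proof (cases "p u = 0")
    case False
    have "(\<integral>\<^sup>+v. ennreal (p u * normal_density (m u) (\<tau> u) v) \<partial>lborel)
        = ennreal (p u) * (\<integral>\<^sup>+v. ennreal (normal_density (m u) (\<tau> u) v) \<partial>lborel)"
      using p_nonneg by (simp add: ennreal_mult' nn_integral_cmult)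
    also have "(\<integral>\<^sup>+v. ennreal (normal_density (m u) (\<tau> u) v) \<partial>lborel) = 1"
      using \<tau>_pos[OF False] by (simp add: nn_integral_eq_integral normal_density_nonneg)
    finally show ?thesis by simp
  qed simp
  with distr_marginal1[OF _ _ D']
  show marginal: "distributed M lborel U (\<lambda>u. ennreal (p u))"
    by (simp add: lborel.sigma_finite_measure_axioms)

  assume [measurable]: "g \<in> borel_measurable borel" and int: "integrable M (\<lambda>\<omega>. g (U \<omega>) * V \<omega>)"
  let ?f = "\<lambda>(u, v). p u * normal_density (m u) (\<tau> u) v"
  let ?h = "\<lambda>(u, v). g u * v"
  have h[measurable]: "?h \<in> borel_measurable borel"
    unfolding borel_prod[symmetric] by measurable
  have D'': "distributed M lborel (\<lambda>\<omega>. (U \<omega>, V \<omega>)) (\<lambda>x. ennreal (?f x))"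
    using D by (simp add: case_prod_unfold)
  have f_nonneg: "0 \<le> ?f x" for x
    using p_nonneg by (auto simp: normal_density_nonneg split: prod.split)
  \<comment> \<open>The integrand \<open>?h\<close> takes both signs, so joint integrability must be
    secured before the integral is iterated.\<close>
  have "integrable lborel (\<lambda>x. ?f x * ?h x)"
    using distributed_integrable[OF D'', of ?h] int f_nonneg by simp
  then have fh: "integrable (lborel \<Otimes>\<^sub>M lborel) (\<lambda>x. ?f x * ?h x)"
    by (simp add: lborel_prod)
  have "expectation (\<lambda>\<omega>. g (U \<omega>) * V \<omega>) = (\<integral>x. ?f x * ?h x \<partial>lborel)"
    using distributed_integral[OF D'', of ?h] f_nonneg by simp
  also have "\<dots> = (\<integral>x. ?f x * ?h x \<partial>(lborel \<Otimes>\<^sub>M lborel))"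
    by (simp add: lborel_prod)
  also have "\<dots> = (\<integral>u. (\<integral>v. p u * normal_density (m u) (\<tau> u) v * (g u * v) \<partial>lborel) \<partial>lborel)"
    using lborel_pair.integral_fst'[OF fh] by simp
  also have "\<dots> = (\<integral>u. p u * (g u * m u) \<partial>lborel)"
  proof (rule Bochner_Integration.integral_cong[OF refl])
    fix u
    show "(\<integral>v. p u * normal_density (m u) (\<tau> u) v * (g u * v) \<partial>lborel) = p u * (g u * m u)"
    proof (cases "p u = 0")
      case False
      have "(\<integral>v. p u * normal_density (m u) (\<tau> u) v * (g u * v) \<partial>lborel)
        = (\<integral>v. p u * g u * (normal_density (m u) (\<tau> u) v * v) \<partial>lborel)"
        by (simp add: ac_simps)
      also have "\<dots> = p u * g u * m u"
        using integral_normal_moment_nz_1[OF \<tau>_pos[OF False], of "m u"] by simp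
      finally show ?thesis by simp
    qed simp
  qed
  also have "\<dots> = expectation (\<lambda>\<omega>. g (U \<omega>) * m (U \<omega>))"
    using p_nonneg by (intro distributed_integral[OF marginal]) auto
  finally show "expectation (\<lambda>\<omega>. g (U \<omega>) * V \<omega>) = expectation (\<lambda>\<omega>. g (U \<omega>) * m (U \<omega>))" .
qed

section \<open>The bivariate normal distribution\<close>

text \<open>Normal moments are taken about the mean, so the centred square is treated first and the
  square-integrable constant \<open>\<mu>\<close> is added back.\<close>

lemma (in prob_space) integrable_square_normal:
  assumes "0 < \<sigma>" and D: "distributed M lborel X (normal_density \<mu> \<sigma>)"
  shows "integrable M (\<lambda>\<omega>. (X \<omega>)\<^sup>2)"
proof -
  have [measurable]: "X \<in> borel_measurable M"
    using distributed_measurable[OF D] by simp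
  have "integrable M (\<lambda>\<omega>. (X \<omega> - \<mu>)\<^sup>2)"
    using integrable_normal_moment[OF assms(1), of \<mu> 2] distributed_integrable[OF D, of "\<lambda>x. (x - \<mu>)\<^sup>2"]
    by (simp add: normal_density_nonneg)
  then have "integrable M (\<lambda>\<omega>. ((X \<omega> - \<mu>) + \<mu>)\<^sup>2)"
    by (intro integrable_square_add) auto
  then show ?thesis by simp
qed

lemma bivariate_normal_density_swap:
  "bivariate_normal_density \<mu>x \<mu>y \<sigma>x \<sigma>y \<rho> (u, v) = bivariate_normal_density \<mu>y \<mu>x \<sigma>y \<sigma>x \<rho> (v, u)"
proof -
  have "x\<^sup>2 - 2 * \<rho> * x * y + y\<^sup>2 = y\<^sup>2 - 2 * \<rho> * y * x + x\<^sup>2" for x y :: real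
    by (simp add: algebra_simps)
  from this[of "(u - \<mu>x) / \<sigma>x" "(v - \<mu>y) / \<sigma>y"] show ?thesis
    unfolding bivariate_normal_density_def prod.case by (simp only: mult.commute[of \<sigma>x] mult.assoc)
qed

text \<open>In standardized coordinates the quadratic form is
  \<open>(w - \<rho> * z)\<^sup>2 + (1 - \<rho>\<^sup>2) * z\<^sup>2\<close>. The first square gives
  the law of \<open>v\<close> given \<open>u\<close>, with the regression line as mean; the second
  gives the marginal of \<open>u\<close>.\<close>

lemma bivariate_normal_density_normal_fibres:
  assumes "0 < \<sigma>x" "0 < \<sigma>y" "-1 < \<rho>" "\<rho> < 1"
  shows "bivariate_normal_density \<mu>x \<mu>y \<sigma>x \<sigma>y \<rho> (u, v) =
    normal_density \<mu>x \<sigma>x u *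
    normal_density (\<mu>y + \<rho> * \<sigma>y / \<sigma>x * (u - \<mu>x)) (\<sigma>y * sqrt (1 - \<rho>\<^sup>2)) v"
proof -
  have r: "0 < 1 - \<rho>\<^sup>2"
    using assms by (simp add: abs_square_less_1)
  define z w where "z = (u - \<mu>x) / \<sigma>x" and "w = (v - \<mu>y) / \<sigma>y"
  have u: "u = \<mu>x + \<sigma>x * z" and v: "v = \<mu>y + \<sigma>y * w"
    using assms by (simp_all add: z_def w_def)
  have e1: "- 1 / (2 * (1 - \<rho>\<^sup>2)) * (z\<^sup>2 - 2 * \<rho> * z * w + w\<^sup>2)
      = - z\<^sup>2 / 2 + - (w - \<rho> * z)\<^sup>2 / (2 * (1 - \<rho>\<^sup>2))"
    using r by (simp add: field_simps power2_eq_square)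
  have e2: "- (u - \<mu>x)\<^sup>2 / (2 * \<sigma>x\<^sup>2) = - z\<^sup>2 / 2"
    using assms by (simp add: u power_mult_distrib)
  have e3: "- (v - (\<mu>y + \<rho> * \<sigma>y / \<sigma>x * (u - \<mu>x)))\<^sup>2 / (2 * (\<sigma>y * sqrt (1 - \<rho>\<^sup>2))\<^sup>2)
      = - (w - \<rho> * z)\<^sup>2 / (2 * (1 - \<rho>\<^sup>2))"
  proof -
    have "v - (\<mu>y + \<rho> * \<sigma>y / \<sigma>x * (u - \<mu>x)) = \<sigma>y * (w - \<rho> * z)"
      using assms by (simp add: u v algebra_simps)
    then show ?thesis
      using assms r by (simp add: power_mult_distrib)
  qed
  \<comment> \<open>The normalising constant splits in the same way as the exponent.\<close>
  have e4: "sqrt (2 * pi * \<sigma>x\<^sup>2) * sqrt (2 * pi * (\<sigma>y * sqrt (1 - \<rho>\<^sup>2))\<^sup>2)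
      = 2 * pi * \<sigma>x * \<sigma>y * sqrt (1 - \<rho>\<^sup>2)"
    using assms r by (simp add: real_sqrt_mult[of "2 * pi"] power_mult_distrib real_sqrt_mult[of "\<sigma>y\<^sup>2"])
  show ?thesis
    unfolding bivariate_normal_density_def normal_density_def prod.case z_def[symmetric] w_def[symmetric]
      e1 e2 e3 e4[symmetric] exp_add
    by simp
qed

lemma (in prob_space) bivariate_normal_marginal1:
  assumes "0 < \<sigma>x" "0 < \<sigma>y" "-1 < \<rho>" "\<rho> < 1"
    and D: "distributed M lborel (\<lambda>\<omega>. (U \<omega>, V \<omega>))
      (\<lambda>u. ennreal (bivariate_normal_density \<mu>x \<mu>y \<sigma>x \<sigma>y \<rho> u))"
  shows "distributed M lborel U (normal_density \<mu>x \<sigma>x)"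
proof -
  have "0 < 1 - \<rho>\<^sup>2"
    using assms by (simp add: abs_square_less_1)
  moreover have "distributed M lborel (\<lambda>\<omega>. (U \<omega>, V \<omega>)) (\<lambda>(u, v). ennreal (normal_density \<mu>x \<sigma>x u *
    normal_density (\<mu>y + \<rho> * \<sigma>y / \<sigma>x * (u - \<mu>x)) (\<sigma>y * sqrt (1 - \<rho>\<^sup>2)) v))"
    using D unfolding bivariate_normal_density_normal_fibres[OF assms(1-4), symmetric] by (simp add: case_prod_unfold)
  ultimately show ?thesis
    using distributed_normal_fibres_marginal[of U V "normal_density \<mu>x \<sigma>x"
        "\<lambda>u. \<mu>y + \<rho> * \<sigma>y / \<sigma>x * (u - \<mu>x)" "\<lambda>_. \<sigma>y * sqrt (1 - \<rho>\<^sup>2)"] assms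
    by (simp add: normal_density_nonneg)
qed

text \<open>Exchanging the coordinates preserves the family of densities, which turns the second
  marginal into a first one.\<close>

lemma (in prob_space) bivariate_normal_marginal2:
  assumes "0 < \<sigma>x" "0 < \<sigma>y" "-1 < \<rho>" "\<rho> < 1"
    and D: "distributed M lborel (\<lambda>\<omega>. (U \<omega>, V \<omega>))
      (\<lambda>u. ennreal (bivariate_normal_density \<mu>x \<mu>y \<sigma>x \<sigma>y \<rho> u))"
  shows "distributed M lborel V (normal_density \<mu>y \<sigma>y)"
proof -
  have "distributed M lborel (\<lambda>\<omega>. (V \<omega>, U \<omega>))
      (\<lambda>u. ennreal (bivariate_normal_density \<mu>y \<mu>x \<sigma>y \<sigma>x \<rho> u))"
  proof -
    have "(\<lambda>(v, u). ennreal (bivariate_normal_density \<mu>x \<mu>y \<sigma>x \<sigma>y \<rho> (u, v))) =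
      (\<lambda>u. ennreal (bivariate_normal_density \<mu>y \<mu>x \<sigma>y \<sigma>x \<rho> u))"
      by (auto simp: bivariate_normal_density_swap[of \<mu>x])
    then show ?thesis
      using distributed_swap[OF lborel.sigma_finite_measure_axioms lborel.sigma_finite_measure_axioms,
          of U V "\<lambda>u. ennreal (bivariate_normal_density \<mu>x \<mu>y \<sigma>x \<sigma>y \<rho> u)"] D
      by (simp add: lborel_prod)
  qed
  then show ?thesis
    by (rule bivariate_normal_marginal1[rotated 4]) (use assms in auto)
qed

text \<open>Centring one factor is enough, so the covariance is the mean of
  \<open>(U - \<mu>x) * V\<close>. Replacing \<open>V\<close> by its regression on \<open>U\<close>
  leaves the slope \<open>\<rho> * \<sigma>y / \<sigma>x\<close> times the variance
  \<open>\<sigma>x\<^sup>2\<close>.\<close>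

lemma (in prob_space) bivariate_normal_covariance:
  assumes "0 < \<sigma>x" "0 < \<sigma>y" "-1 < \<rho>" "\<rho> < 1"
    and D: "distributed M lborel (\<lambda>\<omega>. (U \<omega>, V \<omega>))
      (\<lambda>u. ennreal (bivariate_normal_density \<mu>x \<mu>y \<sigma>x \<sigma>y \<rho> u))"
  shows "covariance M U V = \<rho> * \<sigma>x * \<sigma>y"
proof -
  note DU = bivariate_normal_marginal1[OF assms] and DV = bivariate_normal_marginal2[OF assms]
  have [measurable]: "U \<in> borel_measurable M" "V \<in> borel_measurable M"
    using distributed_measurable[OF DU] distributed_measurable[OF DV] by simp_all
  have sq: "integrable M (\<lambda>\<omega>. (U \<omega>)\<^sup>2)" "integrable M (\<lambda>\<omega>. (V \<omega>)\<^sup>2)"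
    using DU DV assms by (auto intro: integrable_square_normal)
  have int: "integrable M U" "integrable M V"
    using sq by (auto intro: square_integrable_imp_integrable)
  have prod: "integrable M (\<lambda>\<omega>. U \<omega> * V \<omega>)"
    using sq by (auto intro: integrable_product_if_squares)
  have E: "expectation U = \<mu>x" "expectation V = \<mu>y" and var: "variance U = \<sigma>x\<^sup>2"
    using DU DV assms
    by (auto intro: normal_distributed_expectation normal_distributed_variance)
  have r: "0 < 1 - \<rho>\<^sup>2"
    using assms by (simp add: abs_square_less_1)
  have "distributed M lborel (\<lambda>\<omega>. (U \<omega>, V \<omega>)) (\<lambda>(u, v). ennreal (normal_density \<mu>x \<sigma>x u *
    normal_density (\<mu>y + \<rho> * \<sigma>y / \<sigma>x * (u - \<mu>x)) (\<sigma>y * sqrt (1 - \<rho>\<^sup>2)) v))"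
    using D unfolding bivariate_normal_density_normal_fibres[OF assms(1-4), symmetric] by (simp add: case_prod_unfold)
  note fibres = expectation_normal_fibres[OF this, of "\<lambda>u. u - \<mu>x"]
  have "covariance M U V = expectation (\<lambda>\<omega>. (U \<omega> - \<mu>x) * V \<omega> - \<mu>y * (U \<omega> - \<mu>x))"
    unfolding covariance_def E by (intro Bochner_Integration.integral_cong) (auto simp: algebra_simps)
  also have "\<dots> = expectation (\<lambda>\<omega>. (U \<omega> - \<mu>x) * V \<omega>)"
    using int prod E by (simp add: left_diff_distrib prob_space)
  also have "\<dots> = expectation (\<lambda>\<omega>. (U \<omega> - \<mu>x) * (\<mu>y + \<rho> * \<sigma>y / \<sigma>x * (U \<omega> - \<mu>x)))"
    using assms r int prod by (intro fibres) (auto simp: normal_density_nonneg left_diff_distrib)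
  also have "\<dots> = expectation (\<lambda>\<omega>. \<mu>y * (U \<omega> - \<mu>x) + \<rho> * \<sigma>y / \<sigma>x * (U \<omega> - \<mu>x)\<^sup>2)"
    by (simp add: distrib_left power2_eq_square ac_simps)
  also have "\<dots> = \<mu>y * expectation (\<lambda>\<omega>. U \<omega> - \<mu>x) + \<rho> * \<sigma>y / \<sigma>x * expectation (\<lambda>\<omega>. (U \<omega> - \<mu>x)\<^sup>2)"
  proof -
    have "integrable M (\<lambda>\<omega>. (U \<omega> - \<mu>x)\<^sup>2)"
      using sq by (intro integrable_square_diff) auto
    then show ?thesis
      using int by simp
  qed
  also have "\<dots> = \<rho> * \<sigma>x * \<sigma>y"
    using assms var int E by (simp add: prob_space power2_eq_square)
  finally show ?thesis .
qed

section \<open>The bivariate Wishart distribution\<close>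

text \<open>Rescaling the variable by \<open>\<theta>\<close> reduces the integral to Euler's
  integral for \<open>Gamma a\<close>.\<close>

lemma nn_integral_gamma_kernel:
  assumes "0 < a" "0 < \<theta>"
  shows "(\<integral>\<^sup>+x. ennreal (if 0 < x then x powr (a - 1) * exp (- x / \<theta>) else 0) \<partial>lborel)
    = ennreal (Gamma a * \<theta> powr a)"
proof -
  have "(\<integral>\<^sup>+x. ennreal (if 0 < x then x powr (a - 1) * exp (- x / \<theta>) else 0) \<partial>lborel)
    = ennreal \<bar>\<theta>\<bar> * (\<integral>\<^sup>+x. ennreal (if 0 < 0 + \<theta> * x
        then (0 + \<theta> * x) powr (a - 1) * exp (- (0 + \<theta> * x) / \<theta>) else 0) \<partial>lborel)"
    using assms by (intro nn_integral_real_affine) auto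
  also have "\<dots> = ennreal \<theta> * (\<integral>\<^sup>+x. ennreal (\<theta> powr (a - 1)) *
      ennreal (indicator {0..} x * x powr (a - 1) / exp x) \<partial>lborel)"
  proof -
    have "ennreal (if 0 < 0 + \<theta> * x then (0 + \<theta> * x) powr (a - 1) * exp (- (0 + \<theta> * x) / \<theta>) else 0)
      = ennreal (\<theta> powr (a - 1)) * ennreal (indicator {0..} x * x powr (a - 1) / exp x)" for x
      using assms
      \<comment> \<open>At 0 the condition \<open>0 < x\<close> and the indicator of
        \<open>{0..}\<close> disagree, but \<open>0 powr (a - 1)\<close> is 0, so both sides vanish
        there.\<close>
      by (cases "x = 0")
        (auto simp: ennreal_mult'[symmetric] powr_mult zero_less_mult_iff exp_minus field_simps
          split: split_indicator)
    then show ?thesis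
      using assms by simp
  qed
  also have "\<dots> = ennreal \<theta> * (ennreal (\<theta> powr (a - 1)) * ennreal (Gamma a))"
    using assms by (subst nn_integral_cmult) (auto simp: Gamma_conv_nn_integral_real)
  also have "\<dots> = ennreal (Gamma a * (\<theta> * \<theta> powr (a - 1)))"
    using assms Gamma_real_pos[of a] by (simp add: ennreal_mult'[symmetric] ac_simps)
  also have "\<theta> * \<theta> powr (a - 1) = \<theta> powr a"
    using assms by (simp add: powr_diff)
  finally show ?thesis .
qed

text \<open>The constant \<open>K\<close> is left unspecified because total mass one determines it.
  The first moment is the same kernel with shape \<open>a + 1\<close>, and the functional equation
  of \<open>Gamma\<close> turns the ratio of the two integrals into
  \<open>a * \<theta>\<close>.\<close>

lemma (in prob_space) gamma_distributed_mean:
  assumes "0 < a" "0 < \<theta>" "0 \<le> K"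
    and D: "distributed M lborel S
      (\<lambda>x. ennreal (K * (if 0 < x then x powr (a - 1) * exp (- x / \<theta>) else 0)))"
  shows "integrable M S" "expectation S = a * \<theta>" "AE \<omega> in M. 0 < S \<omega>"
proof -
  let ?p = "\<lambda>x. K * (if 0 < x then x powr (a - 1) * exp (- x / \<theta>) else 0)"
  have "(\<integral>\<^sup>+x. ennreal (?p x) * 1 \<partial>lborel) = (\<integral>\<^sup>+\<omega>. 1 \<partial>M)"
    by (rule distributed_nn_integral[OF D]) simp
  then have "ennreal (K * (Gamma a * \<theta> powr a)) = 1"
    using assms nn_integral_gamma_kernel[of a \<theta>]
    by (simp add: emeasure_space_1 ennreal_mult' nn_integral_cmult)
  then have mass: "K * (Gamma a * \<theta> powr a) = 1"
    by (metis ennreal_eq_1)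
  have "(\<integral>\<^sup>+x. ennreal (?p x * x) \<partial>lborel)
    = (\<integral>\<^sup>+x. ennreal K * ennreal (if 0 < x then x powr (a + 1 - 1) * exp (- x / \<theta>) else 0) \<partial>lborel)"
    using assms
    by (intro nn_integral_cong) (auto simp: ennreal_mult'[symmetric] powr_diff)
  also have "\<dots> = ennreal (K * (Gamma (a + 1) * \<theta> powr (a + 1)))"
    using assms nn_integral_gamma_kernel[of "a + 1" \<theta>]
    by (simp add: ennreal_mult' nn_integral_cmult)
  also have "K * (Gamma (a + 1) * \<theta> powr (a + 1)) = a * \<theta>"
  proof -
    have "Gamma (a + 1) = a * Gamma a"
      using assms Gamma_plus1[of a] by (metis nonpos_Ints_nonpos not_le)
    then have "K * (Gamma (a + 1) * \<theta> powr (a + 1)) = K * (Gamma a * \<theta> powr a) * (a * \<theta>)"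
      using assms by (simp add: powr_add)
    then show ?thesis
      using mass by simp
  qed
  finally have "has_bochner_integral lborel (\<lambda>x. ?p x * x) (a * \<theta>)"
    using assms by (intro has_bochner_integral_nn_integral) auto
  then show "integrable M S" "expectation S = a * \<theta>"
    using distributed_integrable[OF D, of "\<lambda>x. x"] distributed_integral[OF D, of "\<lambda>x. x"] assms
    by (auto simp: has_bochner_integral_iff)
  show "AE \<omega> in M. 0 < S \<omega>"
    by (subst distributed_AE2[OF D]) (auto split: if_splits)
qed

section \<open>Marginals and exchange of coordinates for laws on triples\<close>

text \<open>Both laws follow from Tonelli's theorem applied to the iterated integral of
  \<open>f\<close> against an indicator. The first yields the pair (variance, covariance) of a
  Wishart law; the second carries results on the first variance over to the second one.\<close>

lemma (in prob_space)
  fixes f :: "real \<times> real \<times> real \<Rightarrow> ennreal"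
  assumes D: "distributed M lborel W f"
  shows distributed_drop_middle:
      "distributed M lborel (\<lambda>\<omega>. (fst (W \<omega>), snd (snd (W \<omega>)))) (\<lambda>(s, r). \<integral>\<^sup>+t. f (s, t, r) \<partial>lborel)"
    and distributed_swap_first_two:
      "distributed M lborel (\<lambda>\<omega>. (fst (snd (W \<omega>)), fst (W \<omega>), snd (snd (W \<omega>)))) (\<lambda>(t, s, r). f (s, t, r))"
proof -
  \<comment> \<open>The Borel sigma-algebra on triples is rewritten as a product, the form in which
    projections and sections are shown measurable.\<close>
  have f[measurable]: "f \<in> borel_measurable (borel \<Otimes>\<^sub>M borel \<Otimes>\<^sub>M borel)"
    using distributed_borel_measurable[OF D] by (simp add: borel_prod)
  have W[measurable]: "W \<in> measurable M (borel \<Otimes>\<^sub>M borel \<Otimes>\<^sub>M borel)"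
    using distributed_measurable[OF D] by (simp add: borel_prod)
  have iterated: "(\<integral>\<^sup>+\<omega>. g (W \<omega>) \<partial>M)
      = (\<integral>\<^sup>+s. \<integral>\<^sup>+t. \<integral>\<^sup>+r. f (s, t, r) * g (s, t, r) \<partial>lborel \<partial>lborel \<partial>lborel)"
    if [measurable]: "g \<in> borel_measurable (borel \<Otimes>\<^sub>M borel \<Otimes>\<^sub>M borel)" for g
  proof -
    have fg: "(\<lambda>w. f w * g w) \<in> borel_measurable (borel \<Otimes>\<^sub>M borel \<Otimes>\<^sub>M borel)" by measurable
    have "(\<integral>\<^sup>+\<omega>. g (W \<omega>) \<partial>M) = (\<integral>\<^sup>+w. f w * g w \<partial>(lborel \<Otimes>\<^sub>M lborel \<Otimes>\<^sub>M lborel))"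
      using distributed_nn_integral[OF D, of g] that by (simp add: lborel_prod borel_prod)
    also have "\<dots> = (\<integral>\<^sup>+s. \<integral>\<^sup>+w. f (s, w) * g (s, w) \<partial>(lborel \<Otimes>\<^sub>M lborel) \<partial>lborel)"
      using fg by (subst lborel_pair.nn_integral_fst[symmetric]) (auto simp: lborel_prod borel_prod)
    also have "\<dots> = (\<integral>\<^sup>+s. \<integral>\<^sup>+t. \<integral>\<^sup>+r. f (s, t, r) * g (s, t, r) \<partial>lborel \<partial>lborel \<partial>lborel)"
      by (intro nn_integral_cong, subst lborel.nn_integral_fst[symmetric]) auto
    finally show ?thesis .
  qed
  show "distributed M lborel (\<lambda>\<omega>. (fst (W \<omega>), snd (snd (W \<omega>)))) (\<lambda>(s, r). \<integral>\<^sup>+t. f (s, t, r) \<partial>lborel)"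
    unfolding distributed_def
  proof (intro conjI measure_eqI)
    let ?f = "\<lambda>(s, r). \<integral>\<^sup>+t. f (s, t, r) \<partial>lborel"
    have f': "?f \<in> borel_measurable (borel \<Otimes>\<^sub>M borel)" by measurable
    then show "?f \<in> borel_measurable lborel" by (simp add: borel_prod)
    have W': "(\<lambda>\<omega>. (fst (W \<omega>), snd (snd (W \<omega>)))) \<in> measurable M (borel \<Otimes>\<^sub>M borel)" by measurable
    then show W'': "(\<lambda>\<omega>. (fst (W \<omega>), snd (snd (W \<omega>)))) \<in> measurable M lborel" by (simp add: borel_prod)
    fix A :: "(real \<times> real) set" assume "A \<in> sets (distr M lborel (\<lambda>\<omega>. (fst (W \<omega>), snd (snd (W \<omega>)))))"
    then have A: "A \<in> sets borel" by simp
    then have [measurable]: "A \<in> sets (borel \<Otimes>\<^sub>M borel)" unfolding borel_prod .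
    have "emeasure (distr M lborel (\<lambda>\<omega>. (fst (W \<omega>), snd (snd (W \<omega>))))) A
      = (\<integral>\<^sup>+\<omega>. indicator A (fst (W \<omega>), snd (snd (W \<omega>))) \<partial>M)"
      using A W'' by (subst nn_integral_distr[of _ M lborel "indicator A", symmetric]) auto
    also have "\<dots> = (\<integral>\<^sup>+s. \<integral>\<^sup>+t. \<integral>\<^sup>+r. f (s, t, r) * indicator A (s, r) \<partial>lborel \<partial>lborel \<partial>lborel)"
      by (subst iterated) auto
    \<comment> \<open>The two inner integrals are exchanged; the indicator does not depend on
      \<open>t\<close>, so \<open>f\<close> alone is integrated over it.\<close>
    also have "\<dots> = (\<integral>\<^sup>+s. \<integral>\<^sup>+r. \<integral>\<^sup>+t. f (s, t, r) * indicator A (s, r) \<partial>lborel \<partial>lborel \<partial>lborel)"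
      by (intro nn_integral_cong lborel_pair.Fubini') auto
    also have "\<dots> = (\<integral>\<^sup>+s. \<integral>\<^sup>+r. ?f (s, r) * indicator A (s, r) \<partial>lborel \<partial>lborel)"
      by (simp add: nn_integral_multc)
    also have "\<dots> = (\<integral>\<^sup>+x. ?f x * indicator A x \<partial>(lborel \<Otimes>\<^sub>M lborel))"
      by (subst lborel.nn_integral_fst[symmetric]) auto
    also have "\<dots> = emeasure (density lborel ?f) A"
      using A f' by (subst emeasure_density) (auto simp: lborel_prod borel_prod)
    finally show "emeasure (distr M lborel (\<lambda>\<omega>. (fst (W \<omega>), snd (snd (W \<omega>))))) A
      = emeasure (density lborel ?f) A" .
  qed simp
  show "distributed M lborel (\<lambda>\<omega>. (fst (snd (W \<omega>)), fst (W \<omega>), snd (snd (W \<omega>)))) (\<lambda>(t, s, r). f (s, t, r))"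
    unfolding distributed_def
  proof (intro conjI measure_eqI)
    let ?f = "\<lambda>(t, s, r). f (s, t, r)" and ?W = "\<lambda>\<omega>. (fst (snd (W \<omega>)), fst (W \<omega>), snd (snd (W \<omega>)))"
    have f': "?f \<in> borel_measurable (borel \<Otimes>\<^sub>M borel \<Otimes>\<^sub>M borel)" by measurable
    then show "?f \<in> borel_measurable lborel" by (simp add: borel_prod)
    have W': "?W \<in> measurable M (borel \<Otimes>\<^sub>M borel \<Otimes>\<^sub>M borel)" by measurable
    then show W'': "?W \<in> measurable M lborel" by (simp add: borel_prod)
    fix A :: "(real \<times> real \<times> real) set" assume "A \<in> sets (distr M lborel ?W)"
    then have A: "A \<in> sets borel" by simp
    then have [measurable]: "A \<in> sets (borel \<Otimes>\<^sub>M borel \<Otimes>\<^sub>M borel)" unfolding borel_prod .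
    have "emeasure (distr M lborel ?W) A
      = (\<integral>\<^sup>+\<omega>. indicator A (fst (snd (W \<omega>)), fst (W \<omega>), snd (snd (W \<omega>))) \<partial>M)"
      using A W'' by (subst nn_integral_distr[of _ M lborel "indicator A", symmetric]) auto
    also have "\<dots> = (\<integral>\<^sup>+s. \<integral>\<^sup>+t. \<integral>\<^sup>+r. f (s, t, r) * indicator A (t, s, r) \<partial>lborel \<partial>lborel \<partial>lborel)"
      by (subst iterated) auto
    \<comment> \<open>Here the two outer integrals are exchanged.\<close>
    also have "\<dots> = (\<integral>\<^sup>+t. \<integral>\<^sup>+s. \<integral>\<^sup>+r. f (s, t, r) * indicator A (t, s, r) \<partial>lborel \<partial>lborel \<partial>lborel)"
      by (intro lborel_pair.Fubini') auto
    also have "\<dots> = (\<integral>\<^sup>+t. \<integral>\<^sup>+w. ?f (t, w) * indicator A (t, w) \<partial>(lborel \<Otimes>\<^sub>M lborel) \<partial>lborel)"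
      by (intro nn_integral_cong, subst lborel.nn_integral_fst[symmetric]) auto
    also have "\<dots> = (\<integral>\<^sup>+x. ?f x * indicator A x \<partial>(lborel \<Otimes>\<^sub>M lborel \<Otimes>\<^sub>M lborel))"
    proof -
      have "(\<lambda>x. ?f x * indicator A x) \<in> borel_measurable (borel \<Otimes>\<^sub>M borel \<Otimes>\<^sub>M borel)"
        by measurable
      then show ?thesis
        by (subst lborel_pair.nn_integral_fst[symmetric]) (auto simp: lborel_prod borel_prod)
    qed
    also have "\<dots> = emeasure (density lborel ?f) A"
      using A f' by (subst emeasure_density) (auto simp: lborel_prod borel_prod)
    finally show "emeasure (distr M lborel ?W) A = emeasure (density lborel ?f) A" .
  qed simp
qed

section \<open>Factorization and moments of the Wishart density\<close>

lemma bivariate_wishart_density_nonneg: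
  assumes "1 < \<nu>"
  shows "0 \<le> bivariate_wishart_density \<nu> \<gamma>1 \<gamma>2 \<gamma>3 w"
  using assms Gamma_real_pos[of "\<nu> / 2"] Gamma_real_pos[of "(\<nu> - 1) / 2"]
  by (auto simp: bivariate_wishart_density_def split: prod.split)

lemma bivariate_wishart_density_swap:
  "bivariate_wishart_density \<nu> \<gamma>1 \<gamma>2 \<gamma>3 (s, t, r) = bivariate_wishart_density \<nu> \<gamma>2 \<gamma>1 \<gamma>3 (t, s, r)"
proof -
  have "s / \<gamma>1 + t / \<gamma>2 - 2 * \<gamma>3 * r / (\<gamma>1 * \<gamma>2) = t / \<gamma>2 + s / \<gamma>1 - 2 * \<gamma>3 * r / (\<gamma>2 * \<gamma>1)"
    by (simp add: ac_simps)
  then show ?thesis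
    unfolding bivariate_wishart_density_def prod.case
    by (simp only: mult.commute[of \<gamma>1] mult.commute[of s] conj_left_commute)
qed

text \<open>
  With the Schur complement \<open>w = t - r\<^sup>2 / s\<close> one has \<open>s t - r\<^sup>2 = s w\<close>, and completing the
  square in \<open>r\<close> splits the density into a gamma kernel in \<open>s\<close>, a normal density in \<open>r\<close> and a
  gamma kernel in \<open>w\<close>.
\<close>

lemma bivariate_wishart_density_schur:
  assumes \<gamma>1: "0 < \<gamma>1" and \<gamma>2: "0 < \<gamma>2" and det: "0 < \<gamma>1 * \<gamma>2 - \<gamma>3\<^sup>2" and s: "0 < s"
  defines "D \<equiv> \<gamma>1 * \<gamma>2 - \<gamma>3\<^sup>2"
  shows "bivariate_wishart_density \<nu> \<gamma>1 \<gamma>2 \<gamma>3 (s, r\<^sup>2 / s + w, r) =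
    D powr (- \<nu> / 2) / (2 powr \<nu> * sqrt pi * Gamma (\<nu> / 2) * Gamma ((\<nu> - 1) / 2))
    * sqrt (2 * pi * D / \<gamma>1) * (s powr (\<nu> / 2 - 1) * exp (- s / (2 * \<gamma>1)))
    * normal_density (\<gamma>3 / \<gamma>1 * s) (sqrt (s * D / \<gamma>1)) r
    * (if 0 < w then w powr ((\<nu> - 1) / 2 - 1) * exp (- w / (2 * D / \<gamma>1)) else 0)"
proof -
  have D: "0 < D" using det by (simp add: D_def)
  have prod: "s * (r\<^sup>2 / s + w) = r\<^sup>2 + s * w"
    using s by (simp add: field_simps)
  \<comment> \<open>For \<open>s > 0\<close>, positive definiteness of the matrix with diagonal
    \<open>s, t\<close> and off-diagonal entry \<open>r\<close> amounts to positivity of the Schur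
    complement, so the support becomes a half-line in \<open>w\<close>, whatever \<open>r\<close>
    is.\<close>
  have cone: "0 < s \<and> 0 < r\<^sup>2 / s + w \<and> - sqrt (s * (r\<^sup>2 / s + w)) < r \<and> r < sqrt (s * (r\<^sup>2 / s + w))
      \<longleftrightarrow> 0 < w"
  proof
    assume "0 < s \<and> 0 < r\<^sup>2 / s + w \<and> - sqrt (s * (r\<^sup>2 / s + w)) < r \<and> r < sqrt (s * (r\<^sup>2 / s + w))"
    then have "\<bar>r\<bar> < sqrt (r\<^sup>2 + s * w)"
      unfolding prod by auto
    then have "sqrt (r\<^sup>2) < sqrt (r\<^sup>2 + s * w)" by simp
    then have "r\<^sup>2 < r\<^sup>2 + s * w" by (simp only: real_sqrt_less_iff)
    then show "0 < w" using s by (simp add: zero_less_mult_iff)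
  next
    assume w: "0 < w"
    then have "sqrt (r\<^sup>2) < sqrt (r\<^sup>2 + s * w)"
      using s by (intro real_sqrt_less_mono) simp
    then have "\<bar>r\<bar> < sqrt (r\<^sup>2 + s * w)" by (simp only: real_sqrt_abs)
    moreover have "0 < r\<^sup>2 / s + w"
      using s w by (intro add_nonneg_pos) auto
    ultimately show "0 < s \<and> 0 < r\<^sup>2 / s + w \<and> - sqrt (s * (r\<^sup>2 / s + w)) < r \<and> r < sqrt (s * (r\<^sup>2 / s + w))"
      using s unfolding prod by (auto simp: abs_less_iff)
  qed
  show ?thesis
  proof (cases "0 < w")
    case False
    then show ?thesis
      unfolding bivariate_wishart_density_def prod.case cone by simp
  next
    case w: True
    have expo: "- (\<gamma>1 * \<gamma>2) / (2 * D) * (s / \<gamma>1 + (r\<^sup>2 / s + w) / \<gamma>2 - 2 * \<gamma>3 * r / (\<gamma>1 * \<gamma>2))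
        = - s / (2 * \<gamma>1) + - (r - \<gamma>3 / \<gamma>1 * s)\<^sup>2 / (2 * (s * D / \<gamma>1)) + - w / (2 * D / \<gamma>1)"
    proof -
      have "\<gamma>1 * \<gamma>2 * (s / \<gamma>1 + (r\<^sup>2 / s + w) / \<gamma>2 - 2 * \<gamma>3 * r / (\<gamma>1 * \<gamma>2))
          = \<gamma>2 * s + \<gamma>1 * r\<^sup>2 / s + \<gamma>1 * w - 2 * \<gamma>3 * r"
        using \<gamma>1 \<gamma>2 s by (simp add: field_simps)
      \<comment> \<open>Completing the square in \<open>r\<close> takes
        \<open>\<gamma>3\<^sup>2 * s / \<gamma>1\<close> out of \<open>\<gamma>2 * s\<close>; what
        remains is \<open>s * D / \<gamma>1\<close>.\<close>
      also have "\<dots> = s * D / \<gamma>1 + \<gamma>1 / s * (r - \<gamma>3 / \<gamma>1 * s)\<^sup>2 + \<gamma>1 * w"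
        using \<gamma>1 \<gamma>2 s by (simp add: D_def field_simps power2_eq_square)
      finally have *: "\<gamma>1 * \<gamma>2 * (s / \<gamma>1 + (r\<^sup>2 / s + w) / \<gamma>2 - 2 * \<gamma>3 * r / (\<gamma>1 * \<gamma>2))
          = s * D / \<gamma>1 + \<gamma>1 / s * (r - \<gamma>3 / \<gamma>1 * s)\<^sup>2 + \<gamma>1 * w" .
      have "- (\<gamma>1 * \<gamma>2) / (2 * D) * (s / \<gamma>1 + (r\<^sup>2 / s + w) / \<gamma>2 - 2 * \<gamma>3 * r / (\<gamma>1 * \<gamma>2))
          = - (\<gamma>1 * \<gamma>2 * (s / \<gamma>1 + (r\<^sup>2 / s + w) / \<gamma>2 - 2 * \<gamma>3 * r / (\<gamma>1 * \<gamma>2))) / (2 * D)"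
        by (simp only: minus_mult_left times_divide_eq_left)
      also have "\<dots> = - (s * D / \<gamma>1 + \<gamma>1 / s * (r - \<gamma>3 / \<gamma>1 * s)\<^sup>2 + \<gamma>1 * w) / (2 * D)"
        by (simp only: *)
      also have "\<dots> = - s / (2 * \<gamma>1) + - (r - \<gamma>3 / \<gamma>1 * s)\<^sup>2 / (2 * (s * D / \<gamma>1)) + - w / (2 * D / \<gamma>1)"
        using \<gamma>1 s D by (simp add: add_divide_distrib diff_divide_distrib mult.commute)
      finally show ?thesis .
    qed
    \<comment> \<open>The normalising factor of the normal density contributes
      \<open>1 / sqrt s\<close>. Compensating it raises the exponent of \<open>s\<close> to
      \<open>\<nu> / 2 - 1\<close>, while \<open>w\<close> keeps \<open>(\<nu> - 3) / 2\<close>: the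
      gamma shapes are \<open>\<nu> / 2\<close> and \<open>(\<nu> - 1) / 2\<close>.\<close>
    have pow: "(s * w) powr ((\<nu> - 3) / 2) =
        sqrt (2 * pi * D / \<gamma>1) * s powr (\<nu> / 2 - 1) * w powr ((\<nu> - 1) / 2 - 1)
        * (1 / sqrt (2 * pi * (s * D / \<gamma>1)))"
    proof -
      have "s powr (\<nu> / 2 - 1) = s powr ((\<nu> - 3) / 2 + 1 / 2)"
        by (simp add: field_simps)
      also have "\<dots> = s powr ((\<nu> - 3) / 2) * sqrt s"
        using s by (simp only: powr_add powr_half_sqrt less_imp_le)
      finally have "s powr (\<nu> / 2 - 1) = s powr ((\<nu> - 3) / 2) * sqrt s" .
      moreover have "sqrt (2 * pi * (s * D / \<gamma>1)) = sqrt (2 * pi * D / \<gamma>1) * sqrt s"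
        by (simp add: real_sqrt_mult[symmetric] ac_simps)
      moreover have "0 < sqrt (2 * pi * D / \<gamma>1)" "0 < sqrt s"
        using s D \<gamma>1 by simp_all
      moreover have "(s * w) powr ((\<nu> - 3) / 2) = s powr ((\<nu> - 3) / 2) * w powr ((\<nu> - 1) / 2 - 1)"
        using s w by (simp add: powr_mult diff_divide_distrib)
      ultimately show ?thesis
        using D \<gamma>1 by simp
    qed
    have sq: "(sqrt (s * D / \<gamma>1))\<^sup>2 = s * D / \<gamma>1"
      using s D \<gamma>1 by simp
    have det': "s * (r\<^sup>2 / s + w) - r\<^sup>2 = s * w"
      unfolding prod by simp
    show ?thesis
      unfolding bivariate_wishart_density_def prod.case cone det' pow normal_density_def sq
        D_def[symmetric] expo exp_add
      using w by simp
  qed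
qed

text \<open>Integrating out the Schur complement leaves a gamma law of shape
  \<open>\<nu> / 2\<close> and scale \<open>2 * \<gamma>1\<close> for the first variance, with
  normal fibres of mean \<open>\<gamma>3 / \<gamma>1 * s\<close> for the covariance. Integrability
  of the covariance is a premise at this stage because its proof uses the means of both
  variances.\<close>

lemma (in prob_space)
  assumes "1 < \<nu>" "0 < \<gamma>1" "0 < \<gamma>2" "0 < \<gamma>1 * \<gamma>2 - \<gamma>3\<^sup>2"
    and W: "distributed M lborel W (\<lambda>w. ennreal (bivariate_wishart_density \<nu> \<gamma>1 \<gamma>2 \<gamma>3 w))"
  shows wishart_integrable1: "integrable M (\<lambda>\<omega>. fst (W \<omega>))"
    and wishart_expectation1: "expectation (\<lambda>\<omega>. fst (W \<omega>)) = \<nu> * \<gamma>1"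
    and wishart_pos1: "AE \<omega> in M. 0 < fst (W \<omega>)"
    and wishart_expectation_cross: "integrable M (\<lambda>\<omega>. snd (snd (W \<omega>))) \<Longrightarrow>
      expectation (\<lambda>\<omega>. snd (snd (W \<omega>))) = \<nu> * \<gamma>3"
proof -
  define D where "D = \<gamma>1 * \<gamma>2 - \<gamma>3\<^sup>2"
  have D: "0 < D" using assms by (simp add: D_def)
  \<comment> \<open>\<open>C\<close> collects the constants of the factorized density and
    \<open>G\<close> is the mass of the gamma kernel in \<open>w\<close>; their product
    \<open>K\<close> is the constant of the first marginal.\<close>
  define C where "C = D powr (- \<nu> / 2) / (2 powr \<nu> * sqrt pi * Gamma (\<nu> / 2) * Gamma ((\<nu> - 1) / 2))
    * sqrt (2 * pi * D / \<gamma>1)"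
  define G where "G = Gamma ((\<nu> - 1) / 2) * (2 * D / \<gamma>1) powr ((\<nu> - 1) / 2)"
  define K where "K = C * G"
  have C: "0 \<le> C" and G: "0 \<le> G"
    using assms D Gamma_real_pos[of "\<nu> / 2"] Gamma_real_pos[of "(\<nu> - 1) / 2"]
    by (auto simp: C_def G_def)
  then have K: "0 \<le> K" by (simp add: K_def)
  let ?p = "\<lambda>s. K * (if 0 < s then s powr (\<nu> / 2 - 1) * exp (- s / (2 * \<gamma>1)) else 0)"
  let ?nd = "\<lambda>s r. normal_density (\<gamma>3 / \<gamma>1 * s) (sqrt (s * D / \<gamma>1)) r"
  have dens_meas: "bivariate_wishart_density \<nu> \<gamma>1 \<gamma>2 \<gamma>3 \<in> borel_measurable (borel \<Otimes>\<^sub>M borel \<Otimes>\<^sub>M borel)"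
    unfolding bivariate_wishart_density_def by measurable
  note [measurable] = dens_meas
  have fibre: "(\<integral>\<^sup>+t. ennreal (bivariate_wishart_density \<nu> \<gamma>1 \<gamma>2 \<gamma>3 (s, t, r)) \<partial>lborel)
      = ennreal (?p s * ?nd s r)" for s r
  proof (cases "0 < s")
    case False
    then show ?thesis
      by (simp add: bivariate_wishart_density_def)
  next
    case s: True
    let ?q = "C * (s powr (\<nu> / 2 - 1) * exp (- s / (2 * \<gamma>1))) * ?nd s r"
    have q: "0 \<le> ?q"
      using C by (simp add: normal_density_nonneg)
    have "(\<integral>\<^sup>+t. ennreal (bivariate_wishart_density \<nu> \<gamma>1 \<gamma>2 \<gamma>3 (s, t, r)) \<partial>lborel)
      = (\<integral>\<^sup>+w. ennreal (bivariate_wishart_density \<nu> \<gamma>1 \<gamma>2 \<gamma>3 (s, r\<^sup>2 / s + w, r)) \<partial>lborel)"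
      \<comment> \<open>For fixed \<open>s\<close> and \<open>r\<close>, the Schur complement is a
        translate of \<open>t\<close>, so the change of variable has Jacobian 1.\<close>
      by (subst nn_integral_real_affine[where c = 1 and t = "r\<^sup>2 / s"]) auto
    also have "\<dots> = (\<integral>\<^sup>+w. ennreal ?q *
        ennreal (if 0 < w then w powr ((\<nu> - 1) / 2 - 1) * exp (- w / (2 * D / \<gamma>1)) else 0) \<partial>lborel)"
      unfolding bivariate_wishart_density_schur[OF assms(2-4) s] D_def[symmetric] C_def[symmetric]
      using q by (subst ennreal_mult') auto
    also have "\<dots> = ennreal ?q * ennreal G"
      using assms D unfolding G_def by (subst nn_integral_cmult) (simp_all add: nn_integral_gamma_kernel)
    also have "\<dots> = ennreal (?q * G)"
      using q by (simp only: ennreal_mult')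
    also have "?q * G = ?p s * ?nd s r"
      using s by (simp add: K_def mult_ac)
    finally show ?thesis .
  qed
  have pair: "distributed M lborel (\<lambda>\<omega>. (fst (W \<omega>), snd (snd (W \<omega>)))) (\<lambda>(s, r). ennreal (?p s * ?nd s r))"
    using distributed_drop_middle[OF W] by (simp add: fibre)
  have p: "0 \<le> ?p s" "?p s \<noteq> 0 \<Longrightarrow> 0 < sqrt (s * D / \<gamma>1)" for s
    using K D assms by (auto split: if_splits)
  have marginal: "distributed M lborel (\<lambda>\<omega>. fst (W \<omega>)) (\<lambda>s. ennreal (?p s))"
    using p by (intro distributed_normal_fibres_marginal[OF pair]) auto
  note gamma = gamma_distributed_mean[OF _ _ K marginal]
  show "integrable M (\<lambda>\<omega>. fst (W \<omega>))" "AE \<omega> in M. 0 < fst (W \<omega>)"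
    using gamma(1,3) assms by simp_all
  show mean: "expectation (\<lambda>\<omega>. fst (W \<omega>)) = \<nu> * \<gamma>1"
    using gamma(2) assms by simp
  assume "integrable M (\<lambda>\<omega>. snd (snd (W \<omega>)))"
  \<comment> \<open>The factor 1 is the weight \<open>g\<close> of the fibre lemma.\<close>
  then have "expectation (\<lambda>\<omega>. 1 * snd (snd (W \<omega>))) = expectation (\<lambda>\<omega>. 1 * (\<gamma>3 / \<gamma>1 * fst (W \<omega>)))"
    using p by (intro expectation_normal_fibres[OF pair, of "\<lambda>_. 1"]) auto
  then show "expectation (\<lambda>\<omega>. snd (snd (W \<omega>))) = \<nu> * \<gamma>3"
    using mean assms by simp
qed

text \<open>Exchanging the two variances gives a Wishart law with \<open>\<gamma>1\<close> and
  \<open>\<gamma>2\<close> exchanged, which settles the second variance. The covariance is then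
  integrable because it is dominated by the sum of the variances on the support.\<close>

lemma (in prob_space)
  assumes "1 < \<nu>" "0 < \<gamma>1" "0 < \<gamma>2" "0 < \<gamma>1 * \<gamma>2 - \<gamma>3\<^sup>2"
    and W: "distributed M lborel W (\<lambda>w. ennreal (bivariate_wishart_density \<nu> \<gamma>1 \<gamma>2 \<gamma>3 w))"
  shows wishart_integrable2: "integrable M (\<lambda>\<omega>. fst (snd (W \<omega>)))"
    and wishart_expectation2: "expectation (\<lambda>\<omega>. fst (snd (W \<omega>))) = \<nu> * \<gamma>2"
    and wishart_pos2: "AE \<omega> in M. 0 < fst (snd (W \<omega>))"
    and wishart_expectation3: "expectation (\<lambda>\<omega>. snd (snd (W \<omega>))) = \<nu> * \<gamma>3"
proof -
  let ?f = "bivariate_wishart_density \<nu> \<gamma>1 \<gamma>2 \<gamma>3"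
  have "(\<lambda>(t, s, r). ennreal (?f (s, t, r))) = (\<lambda>w. ennreal (bivariate_wishart_density \<nu> \<gamma>2 \<gamma>1 \<gamma>3 w))"
    by (auto simp: bivariate_wishart_density_swap[of _ \<gamma>1])
  then have W': "distributed M lborel (\<lambda>\<omega>. (fst (snd (W \<omega>)), fst (W \<omega>), snd (snd (W \<omega>))))
      (\<lambda>w. ennreal (bivariate_wishart_density \<nu> \<gamma>2 \<gamma>1 \<gamma>3 w))"
    using distributed_swap_first_two[OF W] by simp
  have det: "0 < \<gamma>2 * \<gamma>1 - \<gamma>3\<^sup>2"
    using assms by (simp add: mult.commute)
  show int2: "integrable M (\<lambda>\<omega>. fst (snd (W \<omega>)))"
    and "expectation (\<lambda>\<omega>. fst (snd (W \<omega>))) = \<nu> * \<gamma>2"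
    and "AE \<omega> in M. 0 < fst (snd (W \<omega>))"
    using wishart_integrable1[OF assms(1,3,2) det W'] wishart_expectation1[OF assms(1,3,2) det W']
      wishart_pos1[OF assms(1,3,2) det W'] by simp_all
  have nonneg: "0 \<le> ?f w" for w
    using assms by (intro bivariate_wishart_density_nonneg)
  have "integrable M (\<lambda>\<omega>. fst (W \<omega>) + fst (snd (W \<omega>)))"
    using wishart_integrable1[OF assms] int2 by simp
  moreover have "(\<lambda>w :: real \<times> real \<times> real. fst w + fst (snd w)) \<in> borel_measurable lborel"
    "(\<lambda>w :: real \<times> real \<times> real. snd (snd w)) \<in> borel_measurable lborel"
    by (auto intro!: borel_measurable_continuous_onI continuous_intros)
  note [measurable] = this
  ultimately have "integrable lborel (\<lambda>w. ?f w * (fst w + fst (snd w)))"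
    using distributed_integrable[OF W, of "\<lambda>w. fst w + fst (snd w)"] nonneg by simp
  then have "integrable lborel (\<lambda>w. ?f w * snd (snd w))"
  proof (rule Bochner_Integration.integrable_bound)
    have "?f \<in> borel_measurable lborel"
      using W nonneg by (intro distributed_real_measurable) auto
    then show "(\<lambda>w. ?f w * snd (snd w)) \<in> borel_measurable lborel"
      by simp
    \<comment> \<open>On the support \<open>\<bar>r\<bar>\<close> is below the geometric mean of
      \<open>s\<close> and \<open>t\<close>, hence below \<open>s + t\<close>; elsewhere the density
      is 0.\<close>
    have "\<bar>?f (s, t, r) * r\<bar> \<le> ?f (s, t, r) * (s + t)" for s t r
    proof (cases "0 < s \<and> 0 < t \<and> - sqrt (s * t) < r \<and> r < sqrt (s * t)")
      case True
      then have "\<bar>r\<bar> \<le> sqrt (s * t)" by (auto simp: abs_le_iff)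
      also have "\<dots> \<le> s + t"
        using arith_geo_mean_sqrt[of s t] True by simp
      finally show ?thesis
        using nonneg[of "(s, t, r)"] by (simp add: abs_mult mult_left_mono)
    next
      case False
      then show ?thesis
        by (auto simp: bivariate_wishart_density_def)
    qed
    then show "AE w in lborel. norm (?f w * snd (snd w)) \<le> norm (?f w * (fst w + fst (snd w)))"
      by (auto intro!: order_trans[OF _ abs_ge_self])
  qed
  then have "integrable M (\<lambda>\<omega>. snd (snd (W \<omega>)))"
    using distributed_integrable[OF W, of "\<lambda>w. snd (snd w)"] nonneg by simp
  then show "expectation (\<lambda>\<omega>. snd (snd (W \<omega>))) = \<nu> * \<gamma>3"
    by (rule wishart_expectation_cross[OF assms])
qed

section \<open>Overall moments from conditional moments\<close>

lemma subalgebra_vimage_algebra: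
  assumes "Z \<in> measurable M N"
  shows "subalgebra M (vimage_algebra (space M) Z N)"
  using assms measurable_space[OF assms]
  by (auto simp: subalgebra_def sets_vimage_algebra2 Pi_iff measurable_sets)

text \<open>Internal parameters agree with conditional moments only almost everywhere, so
  covariances have to be transported along such equalities.\<close>

lemma covariance_cong_AE:
  assumes "AE x in M. U x = U' x" "AE x in M. V x = V' x"
    and [measurable]: "U \<in> borel_measurable M" "U' \<in> borel_measurable M"
      "V \<in> borel_measurable M" "V' \<in> borel_measurable M"
  shows "covariance M U V = covariance M U' V'"
proof -
  have "integral\<^sup>L M U = integral\<^sup>L M U'" "integral\<^sup>L M V = integral\<^sup>L M V'"
    using assms by (auto intro: integral_cong_AE)
  moreover have "(\<integral>x. (U x - k) * (V x - l) \<partial>M) = (\<integral>x. (U' x - k) * (V' x - l) \<partial>M)" for k l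
    using assms by (intro integral_cong_AE) auto
  ultimately show ?thesis
    by (simp add: covariance_def)
qed

text \<open>Only integrability of \<open>U\<close> is given. Positivity of \<open>\<theta>2\<close>
  makes the squared residual integrable, the conditional mean inherits square integrability from
  \<open>\<theta>1\<close>, and \<open>U\<close> is the sum of residual and conditional mean. The
  variance formula is then the law of total covariance.\<close>

lemma (in prob_space)
  fixes Z :: "'a \<Rightarrow> 'b::topological_space"
  assumes Z: "Z \<in> borel_measurable M" and U: "integrable M U"
    and mean: "AE \<omega> in M. \<theta>1 \<omega> = cond_expect M Z U \<omega>"
    and var: "AE \<omega> in M. \<theta>2 \<omega> = cond_var M Z U \<omega>"
    and [measurable]: "\<theta>1 \<in> borel_measurable M" and sq: "integrable M (\<lambda>\<omega>. (\<theta>1 \<omega>)\<^sup>2)"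
    and \<theta>2: "integrable M \<theta>2" "AE \<omega> in M. 0 < \<theta>2 \<omega>"
  shows expectation_internal_mean: "expectation U = expectation \<theta>1"
    and integrable_square_internal_var: "integrable M (\<lambda>\<omega>. (U \<omega>)\<^sup>2)"
    and variance_internal_var: "variance U = expectation \<theta>2 + variance \<theta>1"
proof -
  let ?F = "vimage_algebra (space M) Z borel"
  interpret F: finite_measure_subalgebra M ?F
    by standard (rule subalgebra_vimage_algebra[OF Z])
  define A where "A = real_cond_exp M ?F U"
  have [measurable]: "U \<in> borel_measurable M" "A \<in> borel_measurable M"
    using U by (auto simp: A_def)
  have A: "AE \<omega> in M. \<theta>1 \<omega> = A \<omega>"
    using mean by (simp add: A_def cond_expect_def)
  let ?R = "\<lambda>\<omega>. (U \<omega> - A \<omega>)\<^sup>2"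
  have R: "AE \<omega> in M. \<theta>2 \<omega> = real_cond_exp M ?F ?R \<omega>"
    using var by (simp add: A_def cond_expect_def cond_var_def)
  have [measurable]: "\<theta>2 \<in> borel_measurable M"
    using \<theta>2 by auto
  have "AE \<omega> in M. 0 < real_cond_exp M ?F ?R \<omega>"
    using R \<theta>2(2) by eventually_elim simp
  moreover have "integrable M (real_cond_exp M ?F ?R)"
    using integrable_cong_AE[OF _ _ R] \<theta>2 by simp
  moreover have "?R \<in> borel_measurable M"
    by measurable
  ultimately have int_R: "integrable M ?R"
    by (rule F.integrable_if_real_cond_exp_pos[rotated 2]) simp
  then have "expectation ?R = expectation (real_cond_exp M ?F ?R)"
    by (simp add: F.real_cond_exp_int)
  also have "\<dots> = expectation \<theta>2"
    using R by (intro integral_cong_AE) auto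
  finally have E_R: "expectation ?R = expectation \<theta>2" .
  have sq_A: "integrable M (\<lambda>\<omega>. (A \<omega>)\<^sup>2)"
    by (rule integrable_square_cong_AE[OF _ _ sq A]) measurable
  have "integrable M (\<lambda>\<omega>. ((U \<omega> - A \<omega>) + A \<omega>)\<^sup>2)"
    using int_R sq_A by (intro integrable_square_add) auto
  then show sq_U: "integrable M (\<lambda>\<omega>. (U \<omega>)\<^sup>2)" by simp
  have "expectation U = expectation A"
    using U by (simp add: A_def F.real_cond_exp_int)
  also have "\<dots> = expectation \<theta>1"
    using A by (intro integral_cong_AE) auto
  finally show "expectation U = expectation \<theta>1" .
  \<comment> \<open>The variance is treated as the covariance of \<open>U\<close> with
    itself.\<close>
  have "covariance M U U = expectation (\<lambda>\<omega>. (U \<omega> - A \<omega>) * (U \<omega> - A \<omega>)) + covariance M A A"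
    using total_covariance[OF F.subalg, of U U] sq_U sq_A by (simp add: A_def)
  also have "covariance M A A = covariance M \<theta>1 \<theta>1"
    using A by (intro covariance_cong_AE) auto
  finally show "variance U = expectation \<theta>2 + variance \<theta>1"
    using E_R by (simp add: covariance_def power2_eq_square)
qed

text \<open>One \<open>Z\<close> conditions both variables, as the law of total covariance requires;
  it will be the pair of intervals. Square integrability of \<open>U\<close> and \<open>V\<close> is
  a premise because it comes from conditioning on each interval separately.\<close>

lemma (in prob_space) covariance_internal_cov:
  fixes Z :: "'a \<Rightarrow> 'b::topological_space"
  assumes Z: "Z \<in> borel_measurable M"
    and [measurable]: "U \<in> borel_measurable M" "V \<in> borel_measurable M"
      "\<theta>x \<in> borel_measurable M" "\<theta>y \<in> borel_measurable M" "\<theta>xy \<in> borel_measurable M"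
    and sq: "integrable M (\<lambda>\<omega>. (U \<omega>)\<^sup>2)" "integrable M (\<lambda>\<omega>. (V \<omega>)\<^sup>2)"
      "integrable M (\<lambda>\<omega>. (\<theta>x \<omega>)\<^sup>2)" "integrable M (\<lambda>\<omega>. (\<theta>y \<omega>)\<^sup>2)"
    and means: "AE \<omega> in M. \<theta>x \<omega> = cond_expect M Z U \<omega>" "AE \<omega> in M. \<theta>y \<omega> = cond_expect M Z V \<omega>"
    and cov: "AE \<omega> in M. \<theta>xy \<omega> = cond_cov M Z U V \<omega>"
  shows "covariance M U V = expectation \<theta>xy + covariance M \<theta>x \<theta>y"
proof -
  let ?F = "vimage_algebra (space M) Z borel"
  interpret F: finite_measure_subalgebra M ?F
    by standard (rule subalgebra_vimage_algebra[OF Z])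
  define A B where "A = real_cond_exp M ?F U" and "B = real_cond_exp M ?F V"
  have [measurable]: "A \<in> borel_measurable M" "B \<in> borel_measurable M"
    by (auto simp: A_def B_def)
  have AB: "AE \<omega> in M. \<theta>x \<omega> = A \<omega>" "AE \<omega> in M. \<theta>y \<omega> = B \<omega>"
    using means by (simp_all add: A_def B_def cond_expect_def)
  let ?R = "\<lambda>\<omega>. (U \<omega> - A \<omega>) * (V \<omega> - B \<omega>)"
  have R: "AE \<omega> in M. \<theta>xy \<omega> = real_cond_exp M ?F ?R \<omega>"
    using cov by (simp add: A_def B_def cond_expect_def cond_cov_def)
  have sq_AB: "integrable M (\<lambda>\<omega>. (A \<omega>)\<^sup>2)" "integrable M (\<lambda>\<omega>. (B \<omega>)\<^sup>2)"
    by (rule integrable_square_cong_AE[OF _ _ sq(3) AB(1)] integrable_square_cong_AE[OF _ _ sq(4) AB(2)];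
        measurable)+
  have "integrable M (\<lambda>\<omega>. (U \<omega> - A \<omega>)\<^sup>2)" "integrable M (\<lambda>\<omega>. (V \<omega> - B \<omega>)\<^sup>2)"
    using integrable_square_diff[OF _ _ sq(1) sq_AB(1)] integrable_square_diff[OF _ _ sq(2) sq_AB(2)]
    by simp_all
  then have "integrable M ?R"
    by (intro integrable_product_if_squares) auto
  then have "expectation ?R = expectation (real_cond_exp M ?F ?R)"
    by (simp add: F.real_cond_exp_int)
  also have "\<dots> = expectation \<theta>xy"
    using R by (intro integral_cong_AE) auto
  finally have "expectation ?R = expectation \<theta>xy" .
  moreover have "covariance M U V = expectation ?R + covariance M A B"
    using total_covariance[OF F.subalg, of U V] sq sq_AB by (simp add: A_def B_def)
  moreover have "covariance M A B = covariance M \<theta>x \<theta>y"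
    using AB by (intro covariance_cong_AE) auto
  ultimately show ?thesis by simp
qed

section \<open>Maximum likelihood estimators\<close>

text \<open>Cancelling the standard deviations needs both to be nonzero. If a sample variance
  vanishes, so does every deviation in that sample and hence the sample covariance, which matches
  the default value 0 of \<open>mle_corr\<close>.\<close>

lemma mle_corr_sqrt_var:
  assumes "1 \<le> n"
  shows "mle_corr n x y * sqrt (mle_var n x) * sqrt (mle_var n y) = mle_cov n x y"
proof (cases "mle_var n x = 0 \<or> mle_var n y = 0")
  case True
  have "\<forall>i\<in>{1..n}. z i - mle_mean n z = 0" if "mle_var n z = 0" for z
    using that assms by (simp add: mle_var_def sum_nonneg_eq_0_iff)
  then have "mle_cov n x y = 0"
    using True by (auto simp: mle_cov_def intro!: sum.neutral)
  then show ?thesis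
    by (simp add: mle_corr_def)
next
  case False
  then show ?thesis
    by (simp add: mle_corr_def)
qed

lemma mle_gamma_times:
  assumes "\<nu> \<noteq> 0"
  shows "\<nu> * mle_gamma n \<nu> z = 1 / real n * (\<Sum>i=1..n. z i)"
  using assms by (simp add: mle_gamma_def)

theorem mainTheorem2:
  fixes M :: "'a measure"
    and n :: nat
    and X Y :: "nat \<Rightarrow> 'a \<Rightarrow> real \<times> real"
    and \<Theta>1 :: "nat \<Rightarrow> 'a \<Rightarrow> real \<times> real"
    and \<Theta>2 :: "nat \<Rightarrow> 'a \<Rightarrow> real \<times> real \<times> real"
    and Wx Wy :: "nat \<Rightarrow> 'a \<Rightarrow> real"
    and \<mu>x \<mu>y \<sigma>x \<sigma>y \<rho> \<nu> \<gamma>1 \<gamma>2 \<gamma>3 :: real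
    and a b c d :: "nat \<Rightarrow> real"
    and \<theta>1x \<theta>1y \<theta>2x \<theta>2y \<theta>2xy :: "nat \<Rightarrow> real"
  assumes prob: "prob_space M"
    and n: "n \<ge> 1"
    and normal_params: "\<sigma>x > 0" "\<sigma>y > 0" "-1 < \<rho>" "\<rho> < 1"
    and wishart_params: "\<nu> > 2" "\<gamma>1 > 0" "\<gamma>2 > 0" "\<gamma>1 * \<gamma>2 - \<gamma>3\<^sup>2 > 0"
    and intervals: "\<And>i. i \<in> {1..n} \<Longrightarrow> interval_valued_rv M (X i)"
                   "\<And>i. i \<in> {1..n} \<Longrightarrow> interval_valued_rv M (Y i)"
    and one_to_one: "\<And>i. i \<in> {1..n} \<Longrightarrow>
      \<exists>\<phi>. inj_on \<phi> ((\<lambda>\<omega>. (X i \<omega>, Y i \<omega>)) ` space M) \<and>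
          (\<forall>\<omega>\<in>space M. (\<Theta>1 i \<omega>, \<Theta>2 i \<omega>) = \<phi> (X i \<omega>, Y i \<omega>))"
    and normal: "\<And>i. i \<in> {1..n} \<Longrightarrow>
      distributed M lborel (\<Theta>1 i) (\<lambda>u. ennreal (bivariate_normal_density \<mu>x \<mu>y \<sigma>x \<sigma>y \<rho> u))"
    and wishart: "\<And>i. i \<in> {1..n} \<Longrightarrow>
      distributed M lborel (\<Theta>2 i) (\<lambda>w. ennreal (bivariate_wishart_density \<nu> \<gamma>1 \<gamma>2 \<gamma>3 w))"
    and joint: "\<And>i. i \<in> {1..n} \<Longrightarrow>
      distributed M lborel (\<lambda>\<omega>. (\<Theta>1 i \<omega>, \<Theta>2 i \<omega>))
        (\<lambda>(u, w). ennreal (bivariate_normal_density \<mu>x \<mu>y \<sigma>x \<sigma>y \<rho> u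
                           * bivariate_wishart_density \<nu> \<gamma>1 \<gamma>2 \<gamma>3 w))"
    and overall: "\<And>i. i \<in> {1..n} \<Longrightarrow> integrable M (Wx i)"
                 "\<And>i. i \<in> {1..n} \<Longrightarrow> integrable M (Wy i)"
    and internal_means:
      "\<And>i. i \<in> {1..n} \<Longrightarrow> AE \<omega> in M. fst (\<Theta>1 i \<omega>) = cond_expect M (X i) (Wx i) \<omega>"
      "\<And>i. i \<in> {1..n} \<Longrightarrow> AE \<omega> in M. snd (\<Theta>1 i \<omega>) = cond_expect M (Y i) (Wy i) \<omega>"
    and internal_means_joint:
      "\<And>i. i \<in> {1..n} \<Longrightarrow> AE \<omega> in M.
         cond_expect M (\<lambda>\<eta>. (X i \<eta>, Y i \<eta>)) (Wx i) \<omega> = cond_expect M (X i) (Wx i) \<omega>"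
      "\<And>i. i \<in> {1..n} \<Longrightarrow> AE \<omega> in M.
         cond_expect M (\<lambda>\<eta>. (X i \<eta>, Y i \<eta>)) (Wy i) \<omega> = cond_expect M (Y i) (Wy i) \<omega>"
    and internal_vars:
      "\<And>i. i \<in> {1..n} \<Longrightarrow> AE \<omega> in M. fst (\<Theta>2 i \<omega>) = cond_var M (X i) (Wx i) \<omega>"
      "\<And>i. i \<in> {1..n} \<Longrightarrow> AE \<omega> in M. fst (snd (\<Theta>2 i \<omega>)) = cond_var M (Y i) (Wy i) \<omega>"
    and internal_cov:
      "\<And>i. i \<in> {1..n} \<Longrightarrow> AE \<omega> in M.
         snd (snd (\<Theta>2 i \<omega>)) = cond_cov M (\<lambda>\<eta>. (X i \<eta>, Y i \<eta>)) (Wx i) (Wy i) \<omega>"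
    and observed_intervals:
      "\<And>i. i \<in> {1..n} \<Longrightarrow> c i \<le> d i" "\<And>i. i \<in> {1..n} \<Longrightarrow> a i \<le> b i"
    and internally_uniform:
      "\<And>i. i \<in> {1..n} \<Longrightarrow> \<theta>1x i = (c i + d i) / 2"
      "\<And>i. i \<in> {1..n} \<Longrightarrow> \<theta>1y i = (a i + b i) / 2"
      "\<And>i. i \<in> {1..n} \<Longrightarrow> \<theta>2x i = (d i - c i)\<^sup>2 / 12"
      "\<And>i. i \<in> {1..n} \<Longrightarrow> \<theta>2y i = (b i - a i)\<^sup>2 / 12"
      "\<And>i. i \<in> {1..n} \<Longrightarrow> \<theta>2xy i = (d i - c i) * (b i - a i) / 12"
  shows "(\<forall>i\<in>{1..n}.
            prob_space.expectation M (Wx i) = \<mu>x \<and>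
            prob_space.expectation M (Wy i) = \<mu>y \<and>
            prob_space.variance M (Wx i) = \<nu> * \<gamma>1 + \<sigma>x\<^sup>2 \<and>
            prob_space.variance M (Wy i) = \<nu> * \<gamma>2 + \<sigma>y\<^sup>2 \<and>
            covariance M (Wx i) (Wy i) = \<nu> * \<gamma>3 + \<rho> * \<sigma>x * \<sigma>y) \<and>
         mle_mean n \<theta>1x = 1 / (2 * real n) * (\<Sum>i=1..n. c i + d i) \<and>
         mle_mean n \<theta>1y = 1 / (2 * real n) * (\<Sum>i=1..n. a i + b i) \<and>
         \<nu> * mle_gamma n \<nu> \<theta>2x + mle_var n \<theta>1x =
           1 / (12 * real n) * (\<Sum>i=1..n. (d i - c i)\<^sup>2)
           + 1 / real n * (\<Sum>i=1..n. ((c i + d i) / 2 - mle_mean n \<theta>1x)\<^sup>2) \<and>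
         \<nu> * mle_gamma n \<nu> \<theta>2y + mle_var n \<theta>1y =
           1 / (12 * real n) * (\<Sum>i=1..n. (b i - a i)\<^sup>2)
           + 1 / real n * (\<Sum>i=1..n. ((a i + b i) / 2 - mle_mean n \<theta>1y)\<^sup>2) \<and>
         \<nu> * mle_gamma n \<nu> \<theta>2xy
           + mle_corr n \<theta>1x \<theta>1y * sqrt (mle_var n \<theta>1x) * sqrt (mle_var n \<theta>1y) =
           1 / (12 * real n) * (\<Sum>i=1..n. (b i - a i) * (d i - c i))
           + 1 / real n * (\<Sum>i=1..n. ((a i + b i) / 2 - mle_mean n \<theta>1y)
                                    * ((c i + d i) / 2 - mle_mean n \<theta>1x))"
proof -
  interpret prob_space M by fact
  have moments: "expectation (Wx i) = \<mu>x \<and> expectation (Wy i) = \<mu>y \<and>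
      variance (Wx i) = \<nu> * \<gamma>1 + \<sigma>x\<^sup>2 \<and> variance (Wy i) = \<nu> * \<gamma>2 + \<sigma>y\<^sup>2 \<and>
      covariance M (Wx i) (Wy i) = \<nu> * \<gamma>3 + \<rho> * \<sigma>x * \<sigma>y" if i: "i \<in> {1..n}" for i
  proof -
    have [measurable]: "X i \<in> borel_measurable M" "Y i \<in> borel_measurable M"
      using intervals[OF i] by (auto simp: interval_valued_rv_def)
    have XY: "(\<lambda>\<omega>. (X i \<omega>, Y i \<omega>)) \<in> borel_measurable M" by measurable
    have N: "distributed M lborel (\<lambda>\<omega>. (fst (\<Theta>1 i \<omega>), snd (\<Theta>1 i \<omega>)))
        (\<lambda>u. ennreal (bivariate_normal_density \<mu>x \<mu>y \<sigma>x \<sigma>y \<rho> u))"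
      using normal[OF i] by simp
    note Nx = bivariate_normal_marginal1[OF normal_params N]
      and Ny = bivariate_normal_marginal2[OF normal_params N]
    have \<nu>: "1 < \<nu>" using wishart_params by simp
    note wish = \<nu> wishart_params(2-4) wishart[OF i]
    have "\<Theta>2 i \<in> borel_measurable M"
      using distributed_measurable[OF wishart[OF i]] by simp
    then have [measurable]: "\<Theta>2 i \<in> measurable M (borel \<Otimes>\<^sub>M borel \<Otimes>\<^sub>M borel)"
      by (simp add: borel_prod)
    have [measurable]: "(\<lambda>\<omega>. fst (\<Theta>1 i \<omega>)) \<in> borel_measurable M" "(\<lambda>\<omega>. snd (\<Theta>1 i \<omega>)) \<in> borel_measurable M"
      using distributed_measurable[OF Nx] distributed_measurable[OF Ny] by simp_all
    note sq = integrable_square_normal[OF normal_params(1) Nx]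
      integrable_square_normal[OF normal_params(2) Ny]
    \<comment> \<open>These are the premises of the lemmas on internal means and variances, for
      \<open>X i\<close> and for \<open>Y i\<close>; the placeholder stands for measurability of the
      internal mean.\<close>
    note x = overall(1)[OF i] internal_means(1)[OF i] internal_vars(1)[OF i] _ sq(1)
        wishart_integrable1[OF wish] wishart_pos1[OF wish]
      and y = overall(2)[OF i] internal_means(2)[OF i] internal_vars(2)[OF i] _ sq(2)
        wishart_integrable2[OF wish] wishart_pos2[OF wish]
    have "covariance M (Wx i) (Wy i) = expectation (\<lambda>\<omega>. snd (snd (\<Theta>2 i \<omega>)))
        + covariance M (\<lambda>\<omega>. fst (\<Theta>1 i \<omega>)) (\<lambda>\<omega>. snd (\<Theta>1 i \<omega>))"
    proof (rule covariance_internal_cov[OF XY])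
      show "integrable M (\<lambda>\<omega>. (Wx i \<omega>)\<^sup>2)"
        by (rule integrable_square_internal_var[OF _ x]) simp_all
      show "integrable M (\<lambda>\<omega>. (Wy i \<omega>)\<^sup>2)"
        by (rule integrable_square_internal_var[OF _ y]) simp_all
      \<comment> \<open>\<open>internal_means_joint\<close> passes from conditioning on a single
        interval to conditioning on the pair.\<close>
      show "AE \<omega> in M. fst (\<Theta>1 i \<omega>) = cond_expect M (\<lambda>\<omega>. (X i \<omega>, Y i \<omega>)) (Wx i) \<omega>"
        using internal_means(1)[OF i] internal_means_joint(1)[OF i] by eventually_elim simp
      show "AE \<omega> in M. snd (\<Theta>1 i \<omega>) = cond_expect M (\<lambda>\<omega>. (X i \<omega>, Y i \<omega>)) (Wy i) \<omega>"
        using internal_means(2)[OF i] internal_means_joint(2)[OF i] by eventually_elim simp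
    qed (use overall[OF i] sq internal_cov[OF i] in auto)
    moreover have "expectation (Wx i) = \<mu>x"
      using expectation_internal_mean[OF _ x] normal_distributed_expectation[OF normal_params(1) Nx] by simp
    moreover have "expectation (Wy i) = \<mu>y"
      using expectation_internal_mean[OF _ y] normal_distributed_expectation[OF normal_params(2) Ny] by simp
    moreover have "variance (Wx i) = \<nu> * \<gamma>1 + \<sigma>x\<^sup>2"
      using variance_internal_var[OF _ x] normal_distributed_variance[OF normal_params(1) Nx]
        wishart_expectation1[OF wish] by simp
    moreover have "variance (Wy i) = \<nu> * \<gamma>2 + \<sigma>y\<^sup>2"
      using variance_internal_var[OF _ y] normal_distributed_variance[OF normal_params(2) Ny]
        wishart_expectation2[OF wish] by simp
    ultimately show ?thesis
      using wishart_expectation3[OF wish] bivariate_normal_covariance[OF normal_params N] by simp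
  qed
  have mean: "mle_mean n \<theta>1x = 1 / (2 * real n) * (\<Sum>i=1..n. c i + d i)"
    "mle_mean n \<theta>1y = 1 / (2 * real n) * (\<Sum>i=1..n. a i + b i)"
    \<comment> \<open>The congruence rule supplies \<open>i \<in> {1..n}\<close>, under which the
      realizations are known.\<close>
    by (simp_all only: mle_mean_def internally_uniform(1,2) cong: sum.cong)
      (simp_all add: sum_divide_distrib[symmetric])
  have \<nu>_nonzero: "\<nu> \<noteq> 0"
    using wishart_params(1) by simp
  have gamma: "\<nu> * mle_gamma n \<nu> \<theta>2x = 1 / (12 * real n) * (\<Sum>i=1..n. (d i - c i)\<^sup>2)"
    "\<nu> * mle_gamma n \<nu> \<theta>2y = 1 / (12 * real n) * (\<Sum>i=1..n. (b i - a i)\<^sup>2)"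
    "\<nu> * mle_gamma n \<nu> \<theta>2xy = 1 / (12 * real n) * (\<Sum>i=1..n. (b i - a i) * (d i - c i))"
    by (simp_all only: mle_gamma_times[OF \<nu>_nonzero] internally_uniform(3-5) cong: sum.cong)
      (simp_all add: sum_divide_distrib[symmetric] mult.commute)
  have var: "mle_var n \<theta>1x = 1 / real n * (\<Sum>i=1..n. ((c i + d i) / 2 - mle_mean n \<theta>1x)\<^sup>2)"
    "mle_var n \<theta>1y = 1 / real n * (\<Sum>i=1..n. ((a i + b i) / 2 - mle_mean n \<theta>1y)\<^sup>2)"
    "mle_cov n \<theta>1x \<theta>1y = 1 / real n * (\<Sum>i=1..n. ((a i + b i) / 2 - mle_mean n \<theta>1y)
                                    * ((c i + d i) / 2 - mle_mean n \<theta>1x))"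
    by (simp_all only: mle_var_def mle_cov_def internally_uniform(1,2) cong: sum.cong)
  show ?thesis
    \<comment> \<open>The correlation term has to become \<open>mle_cov\<close> first; unfolding
      \<open>var\<close> earlier would rewrite the variances under its square roots.\<close>
    unfolding mle_corr_sqrt_var[OF n] unfolding gamma var
    by (intro conjI mean refl) (use moments in blast)
qed

end
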